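(* Let $W$ be a (finite) Weyl group (not necessarily simple), let $\Lambda_a$ be the root lattice of $W$, let $v\in\mathbb{R}\Lambda_a$, and let $W^+:=W\ltimes\Lambda_a$. Then the group $$W^{v+\Lambda_a}:=\{\rho\in W : \rho(v)-v\in\Lambda_a\}$$ is isomorphic to a finite parabolic subgroup of $W^+$.
   Context: A finite Weyl group $W$ is the group generated by the orthogonal reflections in the roots of a (reduced, crystallographic, possibly reducible) root system in a Euclidean space. The root lattice $\Lambda_a$ is the $\mathbb{Z}$-span of the roots, and $\mathbb{R}\Lambda_a$ its real span. $W^+=W\ltimes\Lambda_a$ is the group of affine transformations of $\mathbb{R}\Lambda_a$ generated by $W$ and the translations by elements of $\Lambda_a$; it is an affine Weyl group, hence a Coxeter group with simple reflections the reflections in the walls of a fundamental chamber (alcove). A parabolic subgroup is a subgroup conjugate to one generated by a subset of the simple reflections. *)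

theory Defs
  imports "HOL-Analysis.Analysis" "HOL-Algebra.Bij" "HOL-Algebra.Generated_Groups"
begin

definition cartan_pairing :: "'a::euclidean_space \<Rightarrow> 'a \<Rightarrow> real"
  where "cartan_pairing x a = 2 * (x \<bullet> a) / (a \<bullet> a)"

definition reflection :: "'a::euclidean_space \<Rightarrow> 'a \<Rightarrow> 'a"
  where "reflection a x = x - cartan_pairing x a *\<^sub>R a"

text \<open>
  Reduced crystallographic root systems.  The roots are not required to span the ambient
  space, so that the ambient type does not fix the rank (in particular, rank 0 is allowed).
\<close>

definition root_system :: "'a::euclidean_space set \<Rightarrow> bool"
  where "root_system R \<longleftrightarrow>
    finite R \<and> 0 \<notin> R \<and>
    (\<forall>a\<in>R. reflection a ` R = R) \<and>
    (\<forall>a\<in>R. \<forall>b\<in>R. cartan_pairing b a \<in> \<int>) \<and>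
    (\<forall>a\<in>R. \<forall>c. c *\<^sub>R a \<in> R \<longrightarrow> c = 1 \<or> c = - 1)"

definition weyl_group :: "'a::euclidean_space set \<Rightarrow> ('a \<Rightarrow> 'a) monoid"
  where "weyl_group R =
    (BijGroup UNIV)\<lparr>carrier := generate (BijGroup UNIV) (reflection ` R)\<rparr>"

text \<open>The integral span of a finite set.\<close>

definition root_lattice :: "'a::euclidean_space set \<Rightarrow> 'a set"
  where "root_lattice R = {\<Sum>a\<in>R. of_int (c a) *\<^sub>R a | c :: 'a \<Rightarrow> int. True}"

definition root_space :: "'a::euclidean_space set \<Rightarrow> 'a set"
  where "root_space R = span (root_lattice R)"

text \<open>
  \<open>W\<^sup>+ = W \<ltimes> \<Lambda>\<^sub>a\<close>, as a group of transformations of the real span of the root lattice.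
  The restrictions are needed because \<^const>\<open>BijGroup\<close> consists of extensional functions.
\<close>

definition affine_weyl_group :: "'a::euclidean_space set \<Rightarrow> ('a \<Rightarrow> 'a) monoid"
  where "affine_weyl_group R =
    (BijGroup (root_space R))\<lparr>carrier := generate (BijGroup (root_space R))
       ((\<lambda>w. restrict w (root_space R)) ` carrier (weyl_group R) \<union>
        (\<lambda>t. \<lambda>x\<in>root_space R. x + t) ` root_lattice R)\<rparr>"

text \<open>
  Since the translations are by the root lattice (not the coroot lattice), the affine
  reflection with linear part \<open>reflection a\<close> and level \<open>k\<close> is \<open>x \<mapsto> reflection a x + k a\<close>; it fixes
  the hyperplane where the pairing with the \<^emph>\<open>coroot\<close> of \<open>a\<close> equals \<open>k\<close>.  Thus \<open>W\<^sup>+\<close> is the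
  usual affine Weyl group of the dual root system.
\<close>

definition affine_hyperplane :: "'a::euclidean_space set \<Rightarrow> 'a \<Rightarrow> int \<Rightarrow> 'a set"
  where "affine_hyperplane R a k = {x \<in> root_space R. cartan_pairing x a = of_int k}"

definition affine_reflection :: "'a::euclidean_space set \<Rightarrow> 'a \<Rightarrow> int \<Rightarrow> 'a \<Rightarrow> 'a"
  where "affine_reflection R a k =
    (\<lambda>x\<in>root_space R. x - (cartan_pairing x a - of_int k) *\<^sub>R a)"

definition alcoves :: "'a::euclidean_space set \<Rightarrow> 'a set set"
  where "alcoves R = components (root_space R - (\<Union>a\<in>R. \<Union>k. affine_hyperplane R a k))"

text \<open>
  A wall of an alcove is a reflecting hyperplane spanned by a face of the alcove.
\<close>

definition is_wall :: "'a::euclidean_space set \<Rightarrow> 'a set \<Rightarrow> bool"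
  where "is_wall A H \<longleftrightarrow> affine hull (closure A \<inter> H) = H"

definition simple_reflections :: "'a::euclidean_space set \<Rightarrow> 'a set \<Rightarrow> ('a \<Rightarrow> 'a) set"
  where "simple_reflections R A =
    {affine_reflection R a k | a k. a \<in> R \<and> is_wall A (affine_hyperplane R a k)}"

definition parabolic_subgroup :: "'a::euclidean_space set \<Rightarrow> 'a set \<Rightarrow> ('a \<Rightarrow> 'a) set \<Rightarrow> bool"
  where "parabolic_subgroup R A P \<longleftrightarrow>
    (\<exists>g\<in>carrier (affine_weyl_group R). \<exists>J\<subseteq>simple_reflections R A.
       P = (\<lambda>p. g \<otimes>\<^bsub>affine_weyl_group R\<^esub> p \<otimes>\<^bsub>affine_weyl_group R\<^esub> inv\<^bsub>affine_weyl_group R\<^esub> g)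
             ` generate (affine_weyl_group R) J)"

definition weyl_coset_stabilizer :: "'a::euclidean_space set \<Rightarrow> 'a \<Rightarrow> ('a \<Rightarrow> 'a) set"
  where "weyl_coset_stabilizer R v = {\<rho> \<in> carrier (weyl_group R). \<rho> v - v \<in> root_lattice R}"


lemma root_lattice_diff:
  assumes "x \<in> root_lattice R" "y \<in> root_lattice R"
  shows "x - y \<in> root_lattice R"
proof -
  obtain c d :: "'a \<Rightarrow> int" where "x = (\<Sum>a\<in>R. of_int (c a) *\<^sub>R a)" "y = (\<Sum>a\<in>R. of_int (d a) *\<^sub>R a)"
    using assms by (auto simp: root_lattice_def)
  then have "x - y = (\<Sum>a\<in>R. of_int (c a - d a) *\<^sub>R a)"
    by (simp add: sum_subtractf algebra_simps)
  then show ?thesis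
    unfolding root_lattice_def mem_Collect_eq by (intro exI[of _ "\<lambda>a. c a - d a"]) simp
qed

lemma root_lattice_zero: "0 \<in> root_lattice R"
  by (auto simp: root_lattice_def intro!: exI[of _ "\<lambda>_. 0"])

lemma root_lattice_add:
  "x \<in> root_lattice R \<Longrightarrow> y \<in> root_lattice R \<Longrightarrow> x + y \<in> root_lattice R"
  using root_lattice_diff[of x R "0 - y"] root_lattice_diff[of 0 R y] root_lattice_zero[of R] by simp

lemma root_lattice_int_scale:
  assumes "finite R" "a \<in> R"
  shows "of_int k *\<^sub>R a \<in> root_lattice R"
proof -
  have "(\<Sum>b\<in>R. of_int (if b = a then k else 0) *\<^sub>R b) = (\<Sum>b\<in>R. if b = a then of_int k *\<^sub>R b else 0)"
    by (intro sum.cong) auto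
  also have "\<dots> = of_int k *\<^sub>R a"
    using assms by simp
  finally have *: "of_int k *\<^sub>R a = (\<Sum>b\<in>R. of_int (if b = a then k else 0) *\<^sub>R b)" ..
  show ?thesis unfolding root_lattice_def mem_Collect_eq
    by (rule exI[of _ "\<lambda>b. if b = a then k else 0"]) (use * in simp)
qed

lemma root_space_eq_span:
  assumes "finite R"
  shows "root_space R = span R"
  unfolding root_space_def
proof (rule span_eq[THEN iffD2], intro conjI subsetI)
  fix x assume "x \<in> root_lattice R"
  then show "x \<in> span R"
    by (auto simp: root_lattice_def intro: span_sum span_scale span_base)
next
  fix a assume "a \<in> R"
  then show "a \<in> span (root_lattice R)"
    using root_lattice_int_scale[OF assms, of a 1] by (auto intro: span_base)
qed

lemma reflection_involution: "a \<noteq> 0 \<Longrightarrow> reflection a (reflection a x) = x"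
  by (simp add: reflection_def cartan_pairing_def algebra_simps inner_diff_left)

lemma linear_reflection: "linear (reflection a)"
  by (rule linearI)
     (auto simp: reflection_def cartan_pairing_def algebra_simps inner_left_distrib add_divide_distrib)

lemma reflection_in_Bij: "root_system R \<Longrightarrow> a \<in> R \<Longrightarrow> reflection a \<in> Bij UNIV"
  unfolding Bij_def bij_betw_def
  by (auto simp: root_system_def inj_def intro: reflection_involution) 
     (metis reflection_involution rangeI)+

lemma affine_reflection_in_affine_weyl_group:
  assumes R: "root_system R" and a: "a \<in> R"
  shows "affine_reflection R a k \<in> carrier (affine_weyl_group R)"
proof -
  let ?V = "root_space R"
  have fin: "finite R" and a0: "a \<noteq> 0" using R a by (auto simp: root_system_def)
  have sub: "subspace ?V" by (simp add: root_space_def)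
  have aV: "a \<in> ?V" using a by (simp add: root_space_eq_span[OF fin] span_base)
  have rV: "reflection a x \<in> ?V" if "x \<in> ?V" for x
    using that sub aV by (simp add: reflection_def subspace_diff subspace_scale)
  have r: "restrict (reflection a) ?V \<in> Bij ?V"
    unfolding Bij_def
    by (auto intro!: bij_betw_byWitness[where f' = "reflection a"] simp: rV reflection_involution[OF a0])
  have t: "(\<lambda>x\<in>?V. x + of_int k *\<^sub>R a) \<in> Bij ?V"
    unfolding Bij_def using sub aV
    by (auto intro!: bij_betw_byWitness[where f' = "\<lambda>x. x - of_int k *\<^sub>R a"]
        simp: subspace_add subspace_diff subspace_scale)
  have "affine_reflection R a k =
      (\<lambda>x\<in>?V. x + of_int k *\<^sub>R a) \<otimes>\<^bsub>BijGroup ?V\<^esub> restrict (reflection a) ?V"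
  proof
    fix x
    show "affine_reflection R a k x =
      ((\<lambda>x\<in>?V. x + of_int k *\<^sub>R a) \<otimes>\<^bsub>BijGroup ?V\<^esub> restrict (reflection a) ?V) x"
    proof (cases "x \<in> ?V")
      case True
      then show ?thesis
        using r t rV[OF True] by (simp add: BijGroup_def compose_def affine_reflection_def)
          (simp add: reflection_def algebra_simps)
    qed (use r t in \<open>simp add: BijGroup_def compose_def affine_reflection_def\<close>)
  qed
  moreover have "reflection a \<in> carrier (weyl_group R)"
    using a by (auto simp: weyl_group_def intro: generate.incl)
  ultimately show ?thesis
    using root_lattice_int_scale[OF fin a, of k] unfolding affine_weyl_group_def
    by (auto intro: generate.eng[OF generate.incl[OF UnI2[OF imageI]] generate.incl[OF UnI1[OF imageI]]])
qed

lemma reflection_root_lattice: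
  assumes R: "root_system R" and a: "a \<in> R" and x: "x \<in> root_lattice R"
  shows "reflection a x \<in> root_lattice R"
proof -
  have fin: "finite R" using R by (simp add: root_system_def)
  obtain c :: "'a \<Rightarrow> int" where c: "x = (\<Sum>b\<in>R. of_int (c b) *\<^sub>R b)"
    using x by (auto simp: root_lattice_def)
  have "cartan_pairing x a = (\<Sum>b\<in>R. of_int (c b) * cartan_pairing b a)"
    by (simp add: c cartan_pairing_def inner_sum_left sum_distrib_left sum_divide_distrib
        mult.left_commute)
  also have "\<dots> \<in> \<int>"
    using R a by (intro Ints_sum Ints_mult Ints_of_int) (simp add: root_system_def)
  finally obtain k where k: "cartan_pairing x a = of_int k"
    by (auto elim: Ints_cases)
  show ?thesis unfolding reflection_def k
    by (intro root_lattice_diff x root_lattice_int_scale fin a)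
qed

lemma group_weyl_group:
  assumes "root_system R"
  shows "group (weyl_group R)"
proof -
  interpret B: group "BijGroup (UNIV :: 'a set)" by (rule group_BijGroup)
  show ?thesis
    unfolding weyl_group_def
    by (intro B.subgroup_imp_group B.generate_is_subgroup)
      (auto simp: BijGroup_def reflection_in_Bij[OF assms])
qed

lemma weyl_group_mult:
  assumes R: "root_system R" and "f \<in> carrier (weyl_group R)" "g \<in> carrier (weyl_group R)"
  shows "f \<otimes>\<^bsub>weyl_group R\<^esub> g = f \<circ> g"
proof -
  interpret B: group "BijGroup (UNIV :: 'a set)" by (rule group_BijGroup)
  have "reflection ` R \<subseteq> carrier (BijGroup UNIV)"
    by (auto simp: BijGroup_def reflection_in_Bij[OF R])
  from B.generate_incl[OF this] have "carrier (weyl_group R) \<subseteq> Bij UNIV"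
    by (simp add: weyl_group_def BijGroup_def)
  with assms show ?thesis
    by (auto simp: weyl_group_def BijGroup_def compose_def)
qed

lemma weyl_group_one: "\<one>\<^bsub>weyl_group R\<^esub> = id"
  by (auto simp: weyl_group_def BijGroup_def)

lemma weyl_group_acts:
  assumes R: "root_system R" and w: "w \<in> carrier (weyl_group R)"
  shows "linear w \<and> (\<forall>x\<in>root_lattice R. w x \<in> root_lattice R)"
proof -
  interpret B: group "BijGroup (UNIV :: 'a set)" by (rule group_BijGroup)
  have r_inv: "inv\<^bsub>BijGroup UNIV\<^esub> (reflection a) = reflection a" if "a \<in> R" for a
  proof (rule B.inv_equality)
    have "a \<noteq> 0" using R that by (auto simp: root_system_def)
    then show "reflection a \<otimes>\<^bsub>BijGroup UNIV\<^esub> reflection a = \<one>\<^bsub>BijGroup UNIV\<^esub>"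
      using reflection_in_Bij[OF R that]
      by (auto simp: BijGroup_def compose_def reflection_involution)
  qed (use reflection_in_Bij[OF R that] in \<open>auto simp: BijGroup_def\<close>)
  have "w \<in> generate (BijGroup UNIV) (reflection ` R)"
    using w by (simp add: weyl_group_def)
  then show ?thesis
  proof induction
    case one
    then show ?case by (auto simp: BijGroup_def linear_iff)
  next
    case (incl h)
    then show ?case by (auto simp: linear_reflection reflection_root_lattice[OF R])
  next
    case (inv h)
    then show ?case by (auto simp: r_inv linear_reflection reflection_root_lattice[OF R])
  next
    case (eng f g)
    then have "f \<otimes>\<^bsub>BijGroup UNIV\<^esub> g = f \<circ> g"
      using weyl_group_mult[OF R, of f g] by (simp add: weyl_group_def)
    with eng show ?case using linear_compose[of g f] by (auto simp: comp_def)
  qed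
qed

lemma subgroup_weyl_coset_stabilizer:
  assumes R: "root_system R"
  shows "subgroup (weyl_coset_stabilizer R v) (weyl_group R)"
proof -
  interpret W: group "weyl_group R" by (rule group_weyl_group[OF R])
  show ?thesis
  proof (rule W.subgroupI)
    show "weyl_coset_stabilizer R v \<noteq> {}"
      using W.one_closed root_lattice_zero[of R]
      by (auto simp: weyl_coset_stabilizer_def weyl_group_one intro!: exI[of _ id])
  next
    fix f assume f: "f \<in> weyl_coset_stabilizer R v"
    then have fW: "f \<in> carrier (weyl_group R)" and fv: "f v - v \<in> root_lattice R"
      by (auto simp: weyl_coset_stabilizer_def)
    let ?g = "inv\<^bsub>weyl_group R\<^esub> f"
    have gW: "?g \<in> carrier (weyl_group R)" using fW by simp
    have "?g \<circ> f = id"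
      using W.l_inv[OF fW] weyl_group_mult[OF R gW fW] by (simp add: weyl_group_one)
    then have "?g v - v = 0 - ?g (f v - v)"
      using weyl_group_acts[OF R gW] by (simp add: linear_diff fun_eq_iff)
    moreover have "0 - ?g (f v - v) \<in> root_lattice R"
      using weyl_group_acts[OF R gW] fv root_lattice_zero by (blast intro: root_lattice_diff)
    ultimately show "?g \<in> weyl_coset_stabilizer R v"
      using gW by (simp add: weyl_coset_stabilizer_def)
  next
    fix f g assume "f \<in> weyl_coset_stabilizer R v" "g \<in> weyl_coset_stabilizer R v"
    then have fW: "f \<in> carrier (weyl_group R)" and fv: "f v - v \<in> root_lattice R"
      and gW: "g \<in> carrier (weyl_group R)" and gv: "g v - v \<in> root_lattice R"
      by (auto simp: weyl_coset_stabilizer_def)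
    have "f (g v) - v = f (g v - v) + (f v - v)"
      using weyl_group_acts[OF R fW] by (simp add: linear_diff)
    also have "\<dots> \<in> root_lattice R"
      using weyl_group_acts[OF R fW] gv fv by (blast intro: root_lattice_add)
    finally show "f \<otimes>\<^bsub>weyl_group R\<^esub> g \<in> weyl_coset_stabilizer R v"
      using W.m_closed[OF fW gW] weyl_group_mult[OF R fW gW]
      by (simp add: weyl_coset_stabilizer_def)
  qed (auto simp: weyl_coset_stabilizer_def)
qed

lemma ex_regular_vector:
  assumes "finite F" "0 \<notin> F" "F \<subseteq> V" "subspace (V::'a::euclidean_space set)"
  shows "\<exists>x\<in>V. \<forall>a\<in>F. x \<bullet> a \<noteq> 0"
  using assms(1,2,3)
proof (induction F)
  case empty
  then show ?case using subspace_0[OF assms(4)] by auto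
next
  case (insert b F)
  then obtain x where x: "x \<in> V" "\<forall>a\<in>F. x \<bullet> a \<noteq> 0" by auto
  define B where "B = (\<lambda>a. - (x \<bullet> a) / (b \<bullet> a)) ` insert b F"
  have "finite (insert 0 B)" using insert.hyps by (simp add: B_def)
  then obtain e where e: "e \<notin> insert 0 B"
    using ex_new_if_finite[OF infinite_UNIV_char_0] by metis
  have "(x + e *\<^sub>R b) \<bullet> a \<noteq> 0" if "a \<in> insert b F" for a
  proof
    assume 0: "(x + e *\<^sub>R b) \<bullet> a = 0"
    show False
    proof (cases "b \<bullet> a = 0")
      case True
      with 0 that x insert.prems show False by (auto simp: inner_left_distrib)
    next
      case False
      with 0 have "e = - (x \<bullet> a) / (b \<bullet> a)" by (simp add: inner_left_distrib field_simps)
      with that e show False by (auto simp: B_def)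
    qed
  qed
  moreover have "x + e *\<^sub>R b \<in> V"
    using x insert.prems assms(4) by (simp add: subspace_add subspace_scale)
  ultimately show ?case by blast
qed

lemma alcoves_nonempty:
  assumes R: "root_system R"
  shows "alcoves R \<noteq> {}"
proof -
  let ?V = "root_space R"
  have fin: "finite R" and R0: "0 \<notin> R" using R by (auto simp: root_system_def)
  have sub: "subspace ?V" by (simp add: root_space_def)
  have "R \<subseteq> ?V" by (auto simp: root_space_eq_span[OF fin] span_base)
  from ex_regular_vector[OF fin R0 this sub]
  obtain x where x: "x \<in> ?V" "\<And>a. a \<in> R \<Longrightarrow> x \<bullet> a \<noteq> 0" by auto
  define M where "M = 1 + (\<Sum>a\<in>R. \<bar>cartan_pairing x a\<bar>)"
  have M: "M > 0" unfolding M_def by (intro add_pos_nonneg sum_nonneg) auto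
  have "x /\<^sub>R M \<notin> affine_hyperplane R a k" if a: "a \<in> R" for a k
  proof
    assume "x /\<^sub>R M \<in> affine_hyperplane R a k"
    then have eq: "cartan_pairing x a / M = of_int k"
      by (simp add: affine_hyperplane_def cartan_pairing_def field_simps)
    have "\<bar>cartan_pairing x a\<bar> \<le> (\<Sum>a\<in>R. \<bar>cartan_pairing x a\<bar>)"
      using member_le_sum[OF a _ fin, of "\<lambda>a. \<bar>cartan_pairing x a\<bar>"] by simp
    then have "\<bar>cartan_pairing x a\<bar> < M" by (simp add: M_def)
    then have "\<bar>cartan_pairing x a / M\<bar> < 1" using M by simp
    then have "k = 0" unfolding eq by linarith
    then have "cartan_pairing x a = 0" using eq M by simp
    then show False using x(2)[OF a] R0 a by (auto simp: cartan_pairing_def)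
  qed
  moreover have "x /\<^sub>R M \<in> ?V" using x sub by (simp add: subspace_scale)
  ultimately have "x /\<^sub>R M \<in> ?V - (\<Union>a\<in>R. \<Union>k. affine_hyperplane R a k)" by blast
  then show ?thesis unfolding alcoves_def by (metis componentsI empty_iff)
qed

end

theory Submission
  imports Defs
begin

text \<open>
  Sending \<open>\<rho>\<close> to \<open>x \<mapsto> \<rho>(x - v) + v\<close> identifies the group of the theorem with the stabilizer of
  \<open>v\<close> in \<open>W\<^sup>+\<close>.  A point of the \<open>W\<^sup>+\<close>-orbit of \<open>v\<close> that is closest to a point of the alcove lies in
  the closed alcove, so the stabilizer of \<open>v\<close> is conjugate to that of a point \<open>v'\<close> there.
  The latter is generated by the walls through \<open>v'\<close>: modulo these reflections an element fixing \<open>v'\<close>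
  can be chosen to map the alcove to itself, and \<open>W\<^sup>+\<close>, being generated by the wall reflections,
  acts freely on alcoves.
\<close>

section \<open>Affine reflections\<close>

text \<open>The passage from connected components to group theory goes through finitely many affine
  functionals. With \<open>lo a\<close> the integer part of the coroot pairing on the alcove, the
  alcove is cut out by \<open>height a x > 0\<close> for all roots a; as R = -R, these conditions
  contain the upper bounds \<open>height a x < 1\<close> as well. What concerns alcoves then becomes
  a sign argument along segments. Finiteness enters twice: W is finite and the root lattice meets
  every ball in a finite set. So W^+-orbits are discrete, and any nonempty set of elements of W^+
  contains one that brings a given point nearest to a target. Generation by wall reflections rests
  on such a choice too: among the reflections outside the generated subgroup, one displacing a point
  of the alcove least could be conjugated by a wall reflection to displace it less.\<close>

text \<open>
  Affine reflections are treated as maps of the whole ambient space rather than as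
  extensional maps of the root space, so that products are plain compositions.
\<close>

definition level :: "'a::euclidean_space \<Rightarrow> int \<Rightarrow> 'a \<Rightarrow> real"
  where "level a k x = cartan_pairing x a - of_int k"

definition aff_refl :: "'a::euclidean_space \<Rightarrow> int \<Rightarrow> 'a \<Rightarrow> 'a"
  where "aff_refl a k x = x - level a k x *\<^sub>R a"

text \<open>Letters are pairs of a root and an integer rather than maps, so that deleting letters
  and inducting on the length make sense.\<close>

fun word :: "('a::euclidean_space \<times> int) list \<Rightarrow> 'a \<Rightarrow> 'a"
  where
    "word [] = id"
  | "word ((a, k) # l) = aff_refl a k \<circ> word l"

definition words :: "('a::euclidean_space \<times> int) set \<Rightarrow> ('a \<Rightarrow> 'a) set"
  where "words T = word ` lists T"

lemma word_append: "word (l @ m) = word l \<circ> word m"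
  by (induction l rule: word.induct) (auto simp: comp_assoc)

lemma words_id: "id \<in> words T"
  unfolding words_def by (rule image_eqI[of _ _ "[]"]) auto

lemma aff_refl_in_words: "(a, k) \<in> T \<Longrightarrow> aff_refl a k \<in> words T"
  unfolding words_def by (rule image_eqI[of _ _ "[(a, k)]"]) auto

lemma words_comp: "f \<in> words T \<Longrightarrow> g \<in> words T \<Longrightarrow> f \<circ> g \<in> words T"
proof -
  assume "f \<in> words T" "g \<in> words T"
  then obtain l m where "l \<in> lists T" "f = word l" "m \<in> lists T" "g = word m"
    by (auto simp: words_def)
  then show "f \<circ> g \<in> words T"
    unfolding words_def by (intro image_eqI[of _ _ "l @ m"]) (simp_all add: word_append)
qed

lemma words_mono: "T \<subseteq> U \<Longrightarrow> words T \<subseteq> words U"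
  unfolding words_def by (intro image_mono lists_mono)

lemma words_induct [consumes 1, case_names id refl]:
  assumes "f \<in> words T" "P id"
    and "\<And>a k f. (a, k) \<in> T \<Longrightarrow> f \<in> words T \<Longrightarrow> P f \<Longrightarrow> P (aff_refl a k \<circ> f)"
  shows "P f"
proof -
  obtain l where l: "l \<in> lists T" "f = word l" using assms(1) by (auto simp: words_def)
  have "P (word l)" using l(1)
    by (induction l rule: word.induct) (auto intro!: assms simp: words_def)
  with l show ?thesis by simp
qed

lemma cartan_pairing_linear: "linear (\<lambda>x. cartan_pairing x a)"
  by (rule linearI) (auto simp: cartan_pairing_def inner_left_distrib algebra_simps add_divide_distrib)

lemmas cartan_pairing_simps =
  linear_add[OF cartan_pairing_linear] linear_diff[OF cartan_pairing_linear]
  linear_scale[OF cartan_pairing_linear] linear_0[OF cartan_pairing_linear]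

lemma cartan_pairing_self: "a \<noteq> 0 \<Longrightarrow> cartan_pairing a a = 2"
  by (simp add: cartan_pairing_def)

lemma cartan_pairing_minus: "cartan_pairing x (- a) = - cartan_pairing x a"
  by (simp add: cartan_pairing_def)

lemma level_affine: "level a k (x + t *\<^sub>R (y - x)) = (1 - t) * level a k x + t * level a k y"
  by (simp add: level_def cartan_pairing_simps algebra_simps)

lemma level_minus: "level (- a) (- k) x = - level a k x"
  by (simp add: level_def cartan_pairing_minus)

text \<open>Each reflection thus has two labels; this is why uniqueness of a hyperplane is later
  stated as an equality of maps \<open>aff_refl c k\<close>.\<close>

lemma aff_refl_minus: "aff_refl (- a) (- k) = aff_refl a k"
  by (rule ext) (simp add: aff_refl_def level_minus)

lemma level_aff_refl_self: "a \<noteq> 0 \<Longrightarrow> level a k (aff_refl a k x) = - level a k x"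
  by (simp add: aff_refl_def level_def cartan_pairing_simps cartan_pairing_self)

lemma aff_refl_involution: "a \<noteq> 0 \<Longrightarrow> aff_refl a k (aff_refl a k x) = x"
  using level_aff_refl_self[of a k x] by (simp add: aff_refl_def)

lemma aff_refl_comp_self: "a \<noteq> 0 \<Longrightarrow> aff_refl a k \<circ> aff_refl a k = id"
  by (rule ext) (simp add: aff_refl_involution)

lemma reflection_eq_aff_refl: "reflection a = aff_refl a 0"
  by (rule ext) (simp add: reflection_def aff_refl_def level_def)

lemma aff_refl_affine:
  "aff_refl a k (x + t *\<^sub>R (y - x)) = aff_refl a k x + t *\<^sub>R (aff_refl a k y - aff_refl a k x)"
  unfolding aff_refl_def level_affine by (simp add: algebra_simps)

lemma words_affine:
  assumes "f \<in> words T"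
  shows "f (x + t *\<^sub>R (y - x)) = f x + t *\<^sub>R (f y - f x)"
  using assms by (induction rule: words_induct) (auto simp: aff_refl_affine)

lemma norm_reflection:
  assumes "b \<noteq> 0" shows "norm (reflection b x) = norm x"
proof -
  have "reflection b x \<bullet> reflection b x = x \<bullet> x"
    using assms by (simp add: reflection_def cartan_pairing_def inner_diff_left inner_diff_right inner_commute field_simps)
  then show ?thesis by (simp add: norm_eq_sqrt_inner)
qed

text \<open>In terms of coroots this is the dual reflection formula; it holds because a reflection
  preserves the norm, so both sides have the denominator \<open>a \<bullet> a\<close>.\<close>

lemma cartan_pairing_reflection:
  assumes "b \<noteq> 0"
  shows "cartan_pairing x (reflection b a) = cartan_pairing x a - cartan_pairing x b * cartan_pairing b a"
proof -
  have "reflection b a \<bullet> reflection b a = a \<bullet> a"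
    using norm_reflection[OF assms, of a] by (simp add: norm_eq_sqrt_inner)
  then have "cartan_pairing x (reflection b a) =
      2 * (x \<bullet> a - cartan_pairing a b * (x \<bullet> b)) / (a \<bullet> a)"
    by (simp add: cartan_pairing_def[of x] reflection_def[of b a] inner_diff_right)
  also have "\<dots> = cartan_pairing x a - cartan_pairing x b * cartan_pairing b a"
    by (simp add: cartan_pairing_def inner_commute[of a b] diff_divide_distrib right_diff_distrib)
  finally show ?thesis .
qed

text \<open>Reflecting x changes the squared distance to y by exactly
  \<open>(a \<bullet> a) * level a k x * level a k y\<close>, which is negative when the hyperplane
  separates x from y. This turns a nearest point into a point on the right side of a
  hyperplane.\<close>

lemma aff_refl_closer:
  assumes "level a k x < 0" "level a k y > 0" "a \<noteq> 0"
  shows "norm (aff_refl a k x - y) < norm (x - y)"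
proof -
  have e: "2 * ((x - y) \<bullet> a) = (a \<bullet> a) * (level a k x - level a k y)"
    using assms(3) by (simp add: level_def cartan_pairing_def inner_diff_left field_simps)
  have "(norm (aff_refl a k x - y))\<^sup>2 = (norm (x - y))\<^sup>2 - level a k x * (2 * ((x - y) \<bullet> a)) + (level a k x)\<^sup>2 * (a \<bullet> a)"
    unfolding power2_norm_eq_inner aff_refl_def
    by (simp add: inner_diff_left inner_diff_right inner_commute power2_eq_square algebra_simps)
  also have "\<dots> = (norm (x - y))\<^sup>2 + (a \<bullet> a) * (level a k x * level a k y)"
    unfolding e by (simp add: algebra_simps power2_eq_square)
  also have "\<dots> < (norm (x - y))\<^sup>2"
    using assms by (simp add: mult_pos_neg mult_neg_pos)
  finally show ?thesis by (simp add: power_less_imp_less_base)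
qed

text \<open>Finitely many strict inequalities survive a small move. The bound
  \<open>e \<le> 1\<close> keeps the moved point on the segment it is taken from.\<close>

lemma finite_small_perturbation:
  fixes p q :: "'b \<Rightarrow> real"
  assumes "finite B" "\<And>b. b \<in> B \<Longrightarrow> p b > 0"
  shows "\<exists>e>0. e \<le> 1 \<and> (\<forall>b\<in>B. p b + e * q b > 0)"
proof -
  have "\<forall>\<^sub>F e in at_right 0. \<forall>b\<in>B. p b + e * q b > 0"
  proof (intro eventually_ball_finite assms(1) ballI)
    fix b assume "b \<in> B"
    have "((\<lambda>e. p b + e * q b) \<longlongrightarrow> p b + 0 * q b) (at_right 0)"
      by (intro tendsto_intros)
    then show "\<forall>\<^sub>F e in at_right 0. p b + e * q b > 0"
      by (rule order_tendstoD(1)) (use assms(2)[OF \<open>b \<in> B\<close>] in simp)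
  qed
  moreover have "\<forall>\<^sub>F e in at_right 0. e \<in> {0<..<1::real}"
    by (rule eventually_at_right_real) simp
  ultimately have "\<forall>\<^sub>F e in at_right 0. e \<in> {0<..<1} \<and> (\<forall>b\<in>B. p b + e * q b > 0)"
    by (rule eventually_elim2) blast
  then obtain e where "e \<in> {0<..<1}" "\<forall>b\<in>B. p b + e * q b > 0"
    using eventually_happens' trivial_limit_at_right_real by blast
  then show ?thesis by (intro exI[of _ e]) auto
qed

section \<open>Groups generated by affine reflections of a root system\<close>

locale root_sys =
  fixes R :: "'a::euclidean_space set"
  assumes root_system: "root_system R"
begin

abbreviation "V \<equiv> root_space R"

definition refs :: "('a \<times> int) set"
  where "refs = R \<times> UNIV"

lemma refs_iff [simp]: "(a, k) \<in> refs \<longleftrightarrow> a \<in> R"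
  by (simp add: refs_def)

lemma finite_R: "finite R" and zero_notin_R: "0 \<notin> R"
  using root_system by (auto simp: root_system_def)

lemma root_nonzero: "a \<in> R \<Longrightarrow> a \<noteq> 0"
  using zero_notin_R by auto

lemma reflection_root: "a \<in> R \<Longrightarrow> b \<in> R \<Longrightarrow> reflection a b \<in> R"
  using root_system by (auto simp: root_system_def)

lemma uminus_root: "a \<in> R \<Longrightarrow> - a \<in> R"
  using reflection_root[of a a] by (simp add: reflection_def cartan_pairing_self root_nonzero scaleR_2)

lemma cartan_pairing_Ints: "a \<in> R \<Longrightarrow> b \<in> R \<Longrightarrow> cartan_pairing a b \<in> \<int>"
  using root_system by (auto simp: root_system_def)

lemma subspace_V: "subspace V"
  by (simp add: root_space_def)

lemma V_eq: "V = span R"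
  by (rule root_space_eq_span[OF finite_R])

lemma R_subset_V: "R \<subseteq> V"
  by (auto simp: V_eq span_base)

lemma lattice_subset_V: "root_lattice R \<subseteq> V"
  by (auto simp: root_space_def span_base)

text \<open>The conjugate reflection has root \<open>reflection b a\<close>, and its integer is
  shifted by m times the pairing of b with a, an integer by the crystallographic condition. The
  clause on norms lets displacements of conjugate reflections be compared.\<close>

lemma aff_refl_conj:
  assumes a: "a \<in> R" and b: "b \<in> R"
  obtains c k' where "c \<in> R" "norm c = norm a" "\<And>x. level a k (aff_refl b m x) = level c k' x"
    "aff_refl a k \<circ> aff_refl b m = aff_refl b m \<circ> aff_refl c k'"
proof -
  have b0: "b \<noteq> 0" using b by (rule root_nonzero)
  let ?c = "reflection b a"
  obtain j where j: "cartan_pairing b a = of_int j"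
    using cartan_pairing_Ints[OF b a] by (auto elim: Ints_cases)
  define k' where "k' = k - m * j"
  have lev: "level a k (aff_refl b m x) = level ?c k' x" for x
    using b0 by (simp add: level_def aff_refl_def cartan_pairing_simps cartan_pairing_reflection j k'_def algebra_simps)
  have "aff_refl a k (aff_refl b m x) = aff_refl b m (aff_refl ?c k' x)" for x
  proof -
    have "aff_refl b m (aff_refl ?c k' x) = aff_refl b m x - level ?c k' x *\<^sub>R reflection b ?c"
      by (simp add: aff_refl_def level_def reflection_def cartan_pairing_simps algebra_simps)
    then show ?thesis using lev by (simp add: aff_refl_def[of a] reflection_involution[OF b0])
  qed
  then show thesis
    using that[of ?c k'] lev norm_reflection[OF b0] reflection_root[OF b a] by (auto simp: fun_eq_iff)
qed

text \<open>The arrangement of hyperplanes is invariant under the group: the side on which f x lies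
  is read off at x itself, from a pulled-back hyperplane.\<close>

lemma words_conj:
  assumes "f \<in> words refs" "a \<in> R"
  shows "\<exists>c k'. c \<in> R \<and> (\<forall>x. level a k (f x) = level c k' x) \<and>
    aff_refl a k \<circ> f = f \<circ> aff_refl c k'"
  using assms
proof (induction arbitrary: a k rule: words_induct)
  case id
  then show ?case by auto
next
  case (refl b m f)
  then have "b \<in> R" by simp
  from aff_refl_conj[OF refl.prems this, of k m] obtain c j where
    c: "c \<in> R" "\<And>x. level a k (aff_refl b m x) = level c j x"
    "aff_refl a k \<circ> aff_refl b m = aff_refl b m \<circ> aff_refl c j" by metis
  from refl.IH[OF c(1), of j] obtain d i where
    d: "d \<in> R" "\<And>x. level c j (f x) = level d i x" "aff_refl c j \<circ> f = f \<circ> aff_refl d i" by metis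
  have "aff_refl a k \<circ> (aff_refl b m \<circ> f) = (aff_refl b m \<circ> f) \<circ> aff_refl d i"
    by (metis c(3) d(3) comp_assoc)
  moreover have "level a k ((aff_refl b m \<circ> f) x) = level d i x" for x
    by (simp add: c(2) d(2))
  ultimately show ?case using d(1) by blast
qed

lemma words_inverse:
  assumes "f \<in> words T" "T \<subseteq> refs"
  shows "\<exists>g\<in>words T. g \<circ> f = id \<and> f \<circ> g = id"
  using assms(1)
proof (induction rule: words_induct)
  case id
  then show ?case using words_id by (metis comp_id)
next
  case (refl a k f)
  then obtain g where g: "g \<in> words T" "g \<circ> f = id" "f \<circ> g = id" by blast
  have a: "aff_refl a k \<circ> aff_refl a k = id"
    using refl.hyps assms(2) by (intro aff_refl_comp_self root_nonzero) auto
  show ?case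
  proof (intro bexI conjI)
    show "(g \<circ> aff_refl a k) \<circ> (aff_refl a k \<circ> f) = id"
      using a g by (metis comp_assoc comp_id)
    show "(aff_refl a k \<circ> f) \<circ> (g \<circ> aff_refl a k) = id"
      using a g by (metis comp_assoc comp_id)
    show "g \<circ> aff_refl a k \<in> words T"
      by (intro words_comp g aff_refl_in_words refl)
  qed
qed

lemma words_closed:
  assumes "f \<in> words refs" "subspace U" "R \<subseteq> U" "x \<in> U"
  shows "f x \<in> U"
  using assms
  by (induction rule: words_induct)
    (auto simp: aff_refl_def intro!: subspace_diff subspace_scale)

lemma words_in_V: "f \<in> words refs \<Longrightarrow> x \<in> V \<Longrightarrow> f x \<in> V"
  by (rule words_closed[OF _ subspace_V R_subset_V])

text \<open>The domain U is a parameter because W acts on the ambient space, whereas W^+ consists of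
  extensional maps of the root space.\<close>

lemma restrict_words_Bij:
  assumes f: "f \<in> words refs" and U: "subspace U" "R \<subseteq> U"
  shows "restrict f U \<in> Bij U"
proof -
  obtain g where g: "g \<in> words refs" "g \<circ> f = id" "f \<circ> g = id" using words_inverse[OF f subset_refl] by blast
  have "bij_betw f U U"
    by (rule bij_betw_byWitness[where f' = g])
      (use g words_closed[OF f U] words_closed[OF g(1) U] in \<open>auto simp: fun_eq_iff\<close>)
  then show ?thesis by (simp add: Bij_def cong: bij_betw_cong)
qed

lemma restrict_words_mult:
  assumes "f \<in> words refs" "g \<in> words refs" "subspace U" "R \<subseteq> U"
  shows "restrict f U \<otimes>\<^bsub>BijGroup U\<^esub> restrict g U = restrict (f \<circ> g) U"
  using restrict_words_Bij[of f U] restrict_words_Bij[of g U] words_closed[of g U] assms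
  by (auto simp: BijGroup_def compose_def fun_eq_iff restrict_def)

lemma subgroup_words:
  assumes T: "T \<subseteq> refs" and U: "subspace U" "R \<subseteq> U"
  shows "subgroup ((\<lambda>f. restrict f U) ` words T) (BijGroup U)"
proof -
  interpret B: group "BijGroup U" by (rule group_BijGroup)
  have T': "f \<in> words refs" if "f \<in> words T" for f using words_mono[OF T] that by auto
  show ?thesis
  proof (rule B.subgroupI)
    show "(\<lambda>f. restrict f U) ` words T \<subseteq> carrier (BijGroup U)"
      using restrict_words_Bij[OF T' U] by (auto simp: BijGroup_def)
    show "(\<lambda>f. restrict f U) ` words T \<noteq> {}" using words_id by auto
  next
    fix p assume "p \<in> (\<lambda>f. restrict f U) ` words T"
    then obtain f where f: "f \<in> words T" "p = restrict f U" by auto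
    obtain g where g: "g \<in> words T" "g \<circ> f = id" using words_inverse[OF f(1) T] by blast
    have "inv\<^bsub>BijGroup U\<^esub> p = restrict g U"
    proof (rule B.inv_equality)
      show "restrict g U \<otimes>\<^bsub>BijGroup U\<^esub> p = \<one>\<^bsub>BijGroup U\<^esub>"
        unfolding f restrict_words_mult[OF T'[OF g(1)] T'[OF f(1)] U] g
        by (auto simp: BijGroup_def)
    qed (use restrict_words_Bij[OF T' U] f g in \<open>auto simp: BijGroup_def\<close>)
    with g show "inv\<^bsub>BijGroup U\<^esub> p \<in> (\<lambda>f. restrict f U) ` words T" by auto
  next
    fix p q assume "p \<in> (\<lambda>f. restrict f U) ` words T" "q \<in> (\<lambda>f. restrict f U) ` words T"
    then show "p \<otimes>\<^bsub>BijGroup U\<^esub> q \<in> (\<lambda>f. restrict f U) ` words T"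
      using restrict_words_mult[OF T' T' U] words_comp[of _ T] by auto
  qed
qed

lemma generate_words:
  assumes T: "T \<subseteq> refs" and U: "subspace U" "R \<subseteq> U"
  shows "generate (BijGroup U) ((\<lambda>(a, k). restrict (aff_refl a k) U) ` T) =
    (\<lambda>f. restrict f U) ` words T"
proof -
  interpret B: group "BijGroup U" by (rule group_BijGroup)
  let ?S = "(\<lambda>(a, k). restrict (aff_refl a k) U) ` T"
  have T': "f \<in> words refs" if "f \<in> words T" for f using words_mono[OF T] that by auto
  show ?thesis
  proof
    show "generate (BijGroup U) ?S \<subseteq> (\<lambda>f. restrict f U) ` words T"
      by (rule B.generate_subgroup_incl[OF _ subgroup_words[OF T U]])
        (auto intro: aff_refl_in_words)
    have "restrict f U \<in> generate (BijGroup U) ?S" if "f \<in> words T" for f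
      using that
    proof (induction rule: words_induct)
      case id
      have "restrict id U = \<one>\<^bsub>BijGroup U\<^esub>" by (auto simp: BijGroup_def)
      then show ?case by (simp only: generate.one)
    next
      case (refl a k f)
      have "restrict (aff_refl a k \<circ> f) U = restrict (aff_refl a k) U \<otimes>\<^bsub>BijGroup U\<^esub> restrict f U"
        using refl T' U by (intro restrict_words_mult[symmetric]) (auto intro: aff_refl_in_words)
      moreover have "restrict (aff_refl a k) U \<in> ?S"
        using refl.hyps(1) by (rule rev_image_eqI) simp
      ultimately show ?case using refl.IH by (simp only: generate.eng generate.incl)
    qed
    then show "(\<lambda>f. restrict f U) ` words T \<subseteq> generate (BijGroup U) ?S" by auto
  qed
qed

lemma carrier_weyl_group: "carrier (weyl_group R) = words (R \<times> {0})"
proof -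
  have "reflection ` R = (\<lambda>(a, k). restrict (aff_refl a k) UNIV) ` (R \<times> {0})"
    by (auto simp: reflection_eq_aff_refl image_iff restrict_UNIV)
  then show ?thesis
    using generate_words[of "R \<times> {0}" UNIV]
    by (auto simp: weyl_group_def refs_def restrict_UNIV)
qed

end

section \<open>The Weyl group and the affine Weyl group\<close>

context root_sys
begin

lemma weyl_words: "carrier (weyl_group R) \<subseteq> words refs"
  unfolding carrier_weyl_group by (rule words_mono) auto

text \<open>The semidirect decomposition: composing with \<open>aff_refl a k\<close> reflects the
  linear and the translation part and adds k a, and the lattice is stable under both
  operations.\<close>

lemma word_decompose:
  assumes "f \<in> words refs"
  shows "\<exists>w\<in>carrier (weyl_group R). \<exists>t\<in>root_lattice R. \<forall>x. f x = w x + t"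
  using assms
proof (induction rule: words_induct)
  case id
  show ?case
    by (intro bexI[of _ id] bexI[of _ 0]) (auto simp: carrier_weyl_group words_id root_lattice_zero)
next
  case (refl a k f)
  then obtain w t where wt: "w \<in> carrier (weyl_group R)" "t \<in> root_lattice R" "\<And>x. f x = w x + t"
    and a: "a \<in> R" by auto
  show ?case
  proof (intro bexI allI)
    show "(aff_refl a k \<circ> f) x = (aff_refl a 0 \<circ> w) x + (reflection a t + of_int k *\<^sub>R a)" for x
      by (simp add: wt aff_refl_def level_def reflection_def cartan_pairing_simps algebra_simps)
    show "aff_refl a 0 \<circ> w \<in> carrier (weyl_group R)"
      using wt a by (auto simp: carrier_weyl_group intro: words_comp aff_refl_in_words)
    show "reflection a t + of_int k *\<^sub>R a \<in> root_lattice R"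
      using wt a by (intro root_lattice_add reflection_root_lattice[OF root_system] root_lattice_int_scale finite_R)
  qed
qed

text \<open>Translation by an integer multiple of a root is the product of the reflections in two
  parallel hyperplanes; a lattice vector is a sum of such multiples.\<close>

lemma translation_in_words:
  assumes "t \<in> root_lattice R"
  shows "(\<lambda>x. x + t) \<in> words refs"
proof -
  obtain c :: "'a \<Rightarrow> int" where c: "t = (\<Sum>a\<in>R. of_int (c a) *\<^sub>R a)"
    using assms by (auto simp: root_lattice_def)
  have "(\<lambda>x. x + (\<Sum>a\<in>F. of_int (c a) *\<^sub>R a)) \<in> words refs" if "finite F" "F \<subseteq> R" for F
    using that
  proof (induction F)
    case empty
    then show ?case using words_id by (simp add: id_def)
  next
    case (insert b F)
    have "aff_refl b (c b) \<circ> aff_refl b 0 \<in> words refs"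
      using insert.prems by (intro words_comp aff_refl_in_words) auto
    moreover have "b \<noteq> 0" using insert.prems root_nonzero by auto
    then have "aff_refl b (c b) \<circ> aff_refl b 0 = (\<lambda>x. x + of_int (c b) *\<^sub>R b)"
      by (auto simp: fun_eq_iff aff_refl_def level_def cartan_pairing_simps cartan_pairing_self algebra_simps)
    ultimately have "(\<lambda>x. x + of_int (c b) *\<^sub>R b) \<circ> (\<lambda>x. x + (\<Sum>a\<in>F. of_int (c a) *\<^sub>R a)) \<in> words refs"
      using insert by (intro words_comp) auto
    with insert.hyps show ?case by (simp add: comp_def add_ac)
  qed
  from this[OF finite_R] show ?thesis by (simp add: c)
qed

lemma weyl_translation_in_words:
  assumes "w \<in> carrier (weyl_group R)" "t \<in> root_lattice R"
  shows "(\<lambda>x. w x + t) \<in> words refs"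
  using words_comp[OF translation_in_words[OF assms(2)] subsetD[OF weyl_words assms(1)]]
  by (simp add: comp_def)

lemma carrier_affine_weyl_group:
  "carrier (affine_weyl_group R) = (\<lambda>f. restrict f V) ` words refs"
proof -
  interpret B: group "BijGroup V" by (rule group_BijGroup)
  let ?S = "(\<lambda>w. restrict w V) ` carrier (weyl_group R) \<union> (\<lambda>t. \<lambda>x\<in>V. x + t) ` root_lattice R"
  have "generate (BijGroup V) ?S \<subseteq> (\<lambda>f. restrict f V) ` words refs"
    using weyl_words translation_in_words
    by (intro B.generate_subgroup_incl[OF _ subgroup_words] subspace_V R_subset_V) auto
  moreover have "restrict f V \<in> generate (BijGroup V) ?S" if f: "f \<in> words refs" for f
  proof -
    obtain w t where wt: "w \<in> carrier (weyl_group R)" "t \<in> root_lattice R" "\<And>x. f x = w x + t"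
      using word_decompose[OF f] by auto
    have "(\<lambda>x. x + t) \<circ> w = f" by (auto simp: wt)
    then have "(\<lambda>x\<in>V. x + t) \<otimes>\<^bsub>BijGroup V\<^esub> restrict w V = restrict f V"
      using restrict_words_mult[OF translation_in_words[OF wt(2)] subsetD[OF weyl_words wt(1)] subspace_V R_subset_V]
      by simp
    then show ?thesis
      using wt by (metis (no_types, lifting) UnI1 UnI2 generate.eng generate.incl image_eqI)
  qed
  ultimately show ?thesis by (auto simp: affine_weyl_group_def)
qed

lemma group_affine_weyl_group: "group (affine_weyl_group R)"
proof -
  interpret B: group "BijGroup V" by (rule group_BijGroup)
  show ?thesis
    using B.subgroup_imp_group[OF subgroup_words[OF subset_refl subspace_V R_subset_V]]
      carrier_affine_weyl_group by (simp add: affine_weyl_group_def)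
qed

lemma affine_weyl_mult:
  "f \<in> words refs \<Longrightarrow> g \<in> words refs \<Longrightarrow>
    restrict f V \<otimes>\<^bsub>affine_weyl_group R\<^esub> restrict g V = restrict (f \<circ> g) V"
  using restrict_words_mult[OF _ _ subspace_V R_subset_V] by (simp add: affine_weyl_group_def)

lemma affine_reflection_eq: "affine_reflection R a k = restrict (aff_refl a k) V"
  by (simp add: affine_reflection_def aff_refl_def level_def fun_eq_iff)

lemma generate_affine_weyl:
  assumes "T \<subseteq> refs"
  shows "generate (affine_weyl_group R) ((\<lambda>(a, k). affine_reflection R a k) ` T) =
    (\<lambda>f. restrict f V) ` words T"
proof -
  interpret B: group "BijGroup V" by (rule group_BijGroup)
  let ?H = "(\<lambda>f. restrict f V) ` words refs"
  have sub: "subgroup ?H (BijGroup V)"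
    by (rule subgroup_words[OF subset_refl subspace_V R_subset_V])
  have eq: "affine_weyl_group R = (BijGroup V)\<lparr>carrier := ?H\<rparr>"
    using carrier_affine_weyl_group by (simp add: affine_weyl_group_def)
  have "(\<lambda>(a, k). restrict (aff_refl a k) V) ` T \<subseteq> ?H"
    using assms by (auto intro!: imageI aff_refl_in_words)
  from B.generate_consistent[OF this sub] generate_words[OF assms subspace_V R_subset_V]
  show ?thesis by (simp add: eq affine_reflection_eq)
qed

section \<open>Finiteness of the Weyl group and discreteness of orbits\<close>

lemma orthogonal_fixed:
  assumes "w \<in> carrier (weyl_group R)" "\<And>a. a \<in> R \<Longrightarrow> z \<bullet> a = 0"
  shows "w z = z"
  using assms(1) unfolding carrier_weyl_group
proof (induction rule: words_induct)
  case (refl a k f)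
  then show ?case using assms(2) by (simp add: aff_refl_def level_def cartan_pairing_def)
qed auto

text \<open>The roots need not span the ambient space, but W fixes their orthogonal complement
  pointwise, so the values on the roots determine an element.\<close>

lemma weyl_eqI:
  assumes w: "w \<in> carrier (weyl_group R)" and w': "w' \<in> carrier (weyl_group R)"
    and eq: "\<And>a. a \<in> R \<Longrightarrow> w a = w' a"
  shows "w = w'"
proof
  fix x
  obtain y z where yz: "y \<in> span R" "\<And>u. u \<in> span R \<Longrightarrow> orthogonal z u" "x = y + z"
    using orthogonal_subspace_decomp_exists[of R x] by metis
  have lin: "linear w" "linear w'" using weyl_group_acts[OF root_system] w w' by auto
  have "w y = w' y" using linear_eq_on_span[OF lin eq] yz by blast
  moreover have "z \<bullet> a = 0" if "a \<in> R" for a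
    using yz(2)[of a] that by (simp add: orthogonal_def span_base)
  ultimately show "w x = w' x"
    using orthogonal_fixed[OF w] orthogonal_fixed[OF w'] lin by (simp add: yz linear_add)
qed

lemma finite_weyl_group: "finite (carrier (weyl_group R))"
proof -
  have root: "w a \<in> R" if "w \<in> carrier (weyl_group R)" "a \<in> R" for w a
    using that unfolding carrier_weyl_group
    by (induction rule: words_induct) (auto simp flip: reflection_eq_aff_refl intro: reflection_root)
  have "(\<lambda>w. restrict w R) ` carrier (weyl_group R) \<subseteq> (\<Pi>\<^sub>E a\<in>R. R)"
    using root by auto
  then have "finite ((\<lambda>w. restrict w R) ` carrier (weyl_group R))"
    by (rule finite_subset) (intro finite_PiE finite_R)
  moreover have "inj_on (\<lambda>w. restrict w R) (carrier (weyl_group R))"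
    by (rule inj_onI, rule weyl_eqI) (simp_all, metis restrict_apply')
  ultimately show ?thesis by (rule finite_imageD)
qed

text \<open>The pairings with all roots are integer coordinates of a lattice vector: bounded on a
  ball by Cauchy-Schwarz, and injective because a vector of the root space orthogonal to every root
  is zero.\<close>

lemma finite_lattice_ball: "finite {t \<in> root_lattice R. norm t \<le> M}"
proof -
  \<comment> \<open>The sum of the bounds for the single roots, hence a common bound for all
    coordinates.\<close>
  define N where "N = (\<Sum>a\<in>R. 2 * (\<bar>M\<bar> * norm a) / (a \<bullet> a))"
  let ?F = "\<lambda>t. \<lambda>a\<in>R. cartan_pairing t a"
  have "cartan_pairing t a \<in> of_int ` {\<lfloor>- N\<rfloor>..\<lceil>N\<rceil>}"
    if t: "t \<in> root_lattice R" "norm t \<le> M" and a: "a \<in> R" for t a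
  proof -
    obtain c :: "'a \<Rightarrow> int" where c: "t = (\<Sum>b\<in>R. of_int (c b) *\<^sub>R b)"
      using t by (auto simp: root_lattice_def)
    have "cartan_pairing t a = (\<Sum>b\<in>R. of_int (c b) * cartan_pairing b a)"
      unfolding c by (simp add: linear_sum[OF cartan_pairing_linear] cartan_pairing_simps)
    also have "\<dots> \<in> \<int>" using a by (intro Ints_sum Ints_mult Ints_of_int cartan_pairing_Ints)
    finally obtain j where j: "cartan_pairing t a = of_int j" by (auto elim: Ints_cases)
    have "\<bar>cartan_pairing t a\<bar> \<le> 2 * (\<bar>M\<bar> * norm a) / (a \<bullet> a)"
    proof -
      have "\<bar>t \<bullet> a\<bar> \<le> norm t * norm a" by (rule Cauchy_Schwarz_ineq2)
      also have "\<dots> \<le> \<bar>M\<bar> * norm a" using t by (intro mult_right_mono) auto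
      finally show ?thesis by (simp add: cartan_pairing_def abs_mult divide_right_mono)
    qed
    also have "\<dots> \<le> N" unfolding N_def
      by (rule member_le_sum[OF a _ finite_R]) auto
    finally have "\<bar>real_of_int j\<bar> \<le> N" by (simp add: j)
    then have "j \<in> {\<lfloor>- N\<rfloor>..\<lceil>N\<rceil>}" by (simp add: abs_le_iff) linarith
    with j show ?thesis by auto
  qed
  then have "?F ` {t \<in> root_lattice R. norm t \<le> M} \<subseteq> (\<Pi>\<^sub>E a\<in>R. of_int ` {\<lfloor>- N\<rfloor>..\<lceil>N\<rceil>})" by auto
  then have "finite (?F ` {t \<in> root_lattice R. norm t \<le> M})"
    by (rule finite_subset) (intro finite_PiE finite_R, auto)
  moreover have "inj_on ?F {t \<in> root_lattice R. norm t \<le> M}"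
  proof (rule inj_onI)
    fix s t assume st: "s \<in> {t \<in> root_lattice R. norm t \<le> M}" "t \<in> {t \<in> root_lattice R. norm t \<le> M}"
      and "?F s = ?F t"
    then have eq: "cartan_pairing s a = cartan_pairing t a" if "a \<in> R" for a
      using that by (metis restrict_apply')
    have "(s - t) \<bullet> a = 0" if "a \<in> R" for a
    proof -
      have "cartan_pairing (s - t) a = 0" using eq[OF that] by (simp add: cartan_pairing_simps)
      then show ?thesis using root_nonzero[OF that] by (simp add: cartan_pairing_def)
    qed
    moreover have "s - t \<in> span R"
      using st lattice_subset_V V_eq by (auto intro!: span_diff)
    ultimately have "orthogonal (s - t) (s - t)"
      by (intro orthogonal_to_span[of "s - t" R]) (auto simp: orthogonal_def)
    then show "s = t" by (simp add: orthogonal_def)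
  qed
  ultimately show ?thesis by (rule finite_imageD)
qed

text \<open>Q may be infinite, but writing its elements as w + t, an image of x within a fixed
  distance of y has bounded t. Finite W and finitely many such t leave finitely many images to
  compare.\<close>

lemma words_minimal_distance:
  assumes Q: "Q \<subseteq> words refs" "Q \<noteq> {}"
  obtains g where "g \<in> Q" "\<And>h. h \<in> Q \<Longrightarrow> norm (g x - y) \<le> norm (h x - y)"
proof -
  obtain g0 where g0: "g0 \<in> Q" using Q by auto
  let ?W = "carrier (weyl_group R)"
  define M where "M = norm (g0 x - y)"
  define D where "D = {z \<in> (\<lambda>g. g x) ` Q. norm (z - y) \<le> M}"
  have "D \<subseteq> (\<Union>w\<in>?W. (\<lambda>t. w x + t) ` {t \<in> root_lattice R. norm t \<le> M + norm y + norm (w x)})"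
  proof
    fix z assume "z \<in> D"
    then obtain g where g: "g \<in> Q" "z = g x" "norm (z - y) \<le> M" by (auto simp: D_def)
    obtain w t where wt: "w \<in> ?W" "t \<in> root_lattice R" "\<And>x. g x = w x + t"
      using word_decompose[of g] g Q by auto
    have "t = (z - y) + y - w x" using g wt by simp
    also have "norm \<dots> \<le> norm (z - y) + norm y + norm (w x)"
      by (meson add_mono norm_triangle_ineq norm_triangle_ineq4 order_refl order_trans)
    finally have "norm t \<le> M + norm y + norm (w x)" using g by simp
    with g wt show "z \<in> (\<Union>w\<in>?W. (\<lambda>t. w x + t) ` {t \<in> root_lattice R. norm t \<le> M + norm y + norm (w x)})"
      by auto
  qed
  then have "finite D"
    by (rule finite_subset) (intro finite_UN_I finite_weyl_group finite_imageI finite_lattice_ball)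
  moreover have g0D: "g0 x \<in> D" using g0 by (auto simp: D_def M_def)
  ultimately obtain z where z: "z \<in> D" "\<And>u. u \<in> D \<Longrightarrow> norm (z - y) \<le> norm (u - y)"
    using ex_is_arg_min_if_finite[of D "\<lambda>u. norm (u - y)"] by (auto simp: is_arg_min_linorder)
  then obtain g where g: "g \<in> Q" "z = g x" by (auto simp: D_def)
  have "norm (g x - y) \<le> norm (h x - y)" if "h \<in> Q" for h
  proof (cases "h x \<in> D")
    case True
    then show ?thesis using z g by auto
  next
    case False
    then have "M < norm (h x - y)" using that by (auto simp: D_def)
    then show ?thesis using z(2)[OF g0D] g by (simp add: M_def)
  qed
  with g show thesis using that by blast
qed

end

section \<open>Alcoves and walls\<close>

locale alcove = root_sys R for R :: "'a::euclidean_space set" +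
  fixes A :: "'a set"
  assumes alcove: "A \<in> alcoves R"
begin

text \<open>The chosen point is immaterial: no hyperplane meets the connected set A, so the integer
  part is the same at all its points.\<close>

definition lo :: "'a \<Rightarrow> int"
  where "lo a = \<lfloor>cartan_pairing (SOME x. x \<in> A) a\<rfloor>"

abbreviation height :: "'a \<Rightarrow> 'a \<Rightarrow> real"
  where "height a \<equiv> level a (lo a)"

lemma alcove_nonempty: "A \<noteq> {}"
  using alcove unfolding alcoves_def by (rule in_components_nonempty)

lemma alcove_subset_V: "A \<subseteq> V"
  using in_components_subset[of A] alcove unfolding alcoves_def by blast

lemma alcove_level_nonzero:
  assumes "x \<in> A" "a \<in> R"
  shows "level a k x \<noteq> 0"
proof -
  have "A \<subseteq> V - (\<Union>a\<in>R. \<Union>k. affine_hyperplane R a k)"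
    using alcove unfolding alcoves_def by (rule in_components_subset)
  with assms show ?thesis by (auto simp: affine_hyperplane_def level_def)
qed

text \<open>A connected set avoiding all hyperplanes cannot change the sign of a height. Conversely
  the right-hand side is convex and avoids them all, so it lies in the component that it
  meets.\<close>

lemma alcove_eq: "A = {x \<in> V. \<forall>a\<in>R. height a x > 0}"
proof
  define x0 where "x0 = (SOME x. x \<in> A)"
  have x0: "x0 \<in> A" using alcove_nonempty by (auto simp: x0_def intro: someI)
  have pos: "height a x0 > 0" if "a \<in> R" for a
    using alcove_level_nonzero[OF x0 that, of "lo a"]
    by (simp add: level_def lo_def flip: x0_def) linarith
  have conn: "connected A" using alcove unfolding alcoves_def by (rule in_components_connected)
  show "A \<subseteq> {x \<in> V. \<forall>a\<in>R. height a x > 0}"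
  proof safe
    fix x assume x: "x \<in> A"
    then show "x \<in> V" using alcove_subset_V by auto
    fix a assume a: "a \<in> R"
    show "height a x > 0"
    proof (rule ccontr)
      assume "\<not> height a x > 0"
      \<comment> \<open>The coroot of a, which expresses the pairing as an inner product.\<close>
      let ?u = "(2 / (a \<bullet> a)) *\<^sub>R a"
      have inn: "?u \<bullet> z = cartan_pairing z a" for z
        by (simp add: cartan_pairing_def inner_commute)
      have "?u \<bullet> x \<le> lo a" "lo a \<le> ?u \<bullet> x0"
        unfolding inn using \<open>\<not> height a x > 0\<close> pos[OF a] by (auto simp: level_def)
      from connected_ivt_hyperplane[OF conn x x0 this] obtain z where
        "z \<in> A" "cartan_pairing z a = lo a" unfolding inn by auto
      then show False using alcove_level_nonzero[of z a "lo a"] a by (simp add: level_def)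
    qed
  qed
  let ?B = "{x \<in> V. \<forall>a\<in>R. height a x > 0}"
  have "convex ?B"
  proof (rule convexI)
    fix x y :: 'a and u v :: real
    assume xy: "x \<in> ?B" "y \<in> ?B" and uv: "0 \<le> u" "0 \<le> v" "u + v = 1"
    have e: "u *\<^sub>R x + v *\<^sub>R y = x + v *\<^sub>R (y - x)"
      using uv by (simp add: algebra_simps flip: scaleR_add_left)
    have "height a (u *\<^sub>R x + v *\<^sub>R y) > 0" if "a \<in> R" for a
    proof -
      have "height a x > 0" "height a y > 0" using xy that by auto
      then have "u * height a x + v * height a y > 0" using uv
        by (metis add_nonneg_pos add_pos_nonneg less_eq_real_def mult_nonneg_nonneg mult_pos_pos zero_neq_one add_0)
      moreover have "1 - v = u" using uv by simp
      ultimately show ?thesis unfolding e level_affine by simp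
    qed
    moreover have "u *\<^sub>R x + v *\<^sub>R y \<in> V"
      using xy subspace_V by (auto intro: subspace_add subspace_scale)
    ultimately show "u *\<^sub>R x + v *\<^sub>R y \<in> ?B" by auto
  qed
  then have "connected ?B" by (rule convex_connected)
  moreover have "?B \<subseteq> V - (\<Union>a\<in>R. \<Union>k. affine_hyperplane R a k)"
  proof safe
    fix x a k assume x: "\<forall>a\<in>R. height a x > 0" and a: "a \<in> R"
      and k: "x \<in> affine_hyperplane R a k"
    have m: "- a \<in> R" using a by (rule uminus_root)
    have "lo a < k" using x a k by (auto simp: affine_hyperplane_def level_def)
    moreover have "lo (- a) < - k"
      using bspec[OF x m] k by (auto simp: affine_hyperplane_def level_def cartan_pairing_minus)
    \<comment> \<open>The integer parts of p and -p add up to 0 or -1, whereas lying on the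
      hyperplane with integer k would force a sum of at most -2.\<close>
    moreover have "lo a + lo (- a) \<ge> -1"
      by (simp add: lo_def cartan_pairing_minus floor_minus) linarith
    ultimately show False by linarith
  qed
  moreover have "A \<inter> ?B \<noteq> {}" using x0 pos alcove_subset_V by auto
  ultimately show "?B \<subseteq> A"
    using alcove unfolding alcoves_def by (metis (no_types, lifting) components_maximal)
qed

lemma alcove_height: "x \<in> A \<Longrightarrow> a \<in> R \<Longrightarrow> height a x > 0"
  using alcove_eq by auto

lemma alcoveI: "x \<in> V \<Longrightarrow> (\<And>a. a \<in> R \<Longrightarrow> height a x > 0) \<Longrightarrow> x \<in> A"
  using alcove_eq by auto

lemma lo_minus:
  assumes "a \<in> R"
  shows "lo (- a) = - lo a - 1"
proof -
  define x0 where "x0 = (SOME x. x \<in> A)"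
  have "x0 \<in> A" using alcove_nonempty by (auto simp: x0_def intro: someI)
  then have "level a (lo a) x0 > 0" "level (- a) (lo (- a)) x0 > 0"
    using alcove_height assms uminus_root by auto
  then show ?thesis
    by (simp add: level_def lo_def cartan_pairing_minus flip: x0_def) linarith
qed

lemma height_minus: "a \<in> R \<Longrightarrow> height (- a) x = 1 - height a x"
  by (simp add: lo_minus level_def cartan_pairing_minus)

lemma toward_alcove:
  assumes y: "y \<in> V" "\<And>a. a \<in> R \<Longrightarrow> height a y \<ge> 0" and x: "x \<in> A" and t: "0 < t" "t \<le> 1"
  shows "y + t *\<^sub>R (x - y) \<in> A"
proof (rule alcoveI)
  show "y + t *\<^sub>R (x - y) \<in> V"
    using y x alcove_subset_V by (intro subspace_add subspace_scale subspace_diff subspace_V) auto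
  fix a assume a: "a \<in> R"
  show "height a (y + t *\<^sub>R (x - y)) > 0"
    unfolding level_affine using y(2)[OF a] alcove_height[OF x a] t
    by (intro add_nonneg_pos) auto
qed

lemma closure_alcoveI:
  assumes y: "y \<in> V" "\<And>a. a \<in> R \<Longrightarrow> height a y \<ge> 0"
  shows "y \<in> closure A"
  unfolding closure_approachable
proof (intro allI impI)
  fix e :: real assume e: "e > 0"
  obtain x where x: "x \<in> A" using alcove_nonempty by auto
  \<comment> \<open>Adding 1 to the norm avoids a zero denominator; the factor 2 makes the final
    estimate strict.\<close>
  define t where "t = min 1 (e / (2 * (norm (x - y) + 1)))"
  have n: "norm (x - y) + 1 > 0" by (simp add: add_nonneg_pos)
  have t: "0 < t" "t \<le> 1" using e n by (auto simp: t_def)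
  have "t * norm (x - y) \<le> t * (norm (x - y) + 1)" using t by simp
  also have "\<dots> \<le> e / (2 * (norm (x - y) + 1)) * (norm (x - y) + 1)"
    by (rule mult_right_mono) (auto simp: t_def)
  also have "\<dots> = e / 2" using n by (simp add: field_simps)
  also have "\<dots> < e" using e by simp
  finally have "dist (y + t *\<^sub>R (x - y)) y < e" using t by (simp add: dist_norm)
  then show "\<exists>z\<in>A. dist z y < e" using toward_alcove[OF y x t] by blast
qed

text \<open>The point y lies in the relative interior of a facet. Including -a among the b is
  harmless, since \<open>height (- a) y = 1\<close> when \<open>height a y = 0\<close>.\<close>

definition wall_root :: "'a \<Rightarrow> bool"
  where "wall_root a \<longleftrightarrow> a \<in> R \<and>
    (\<exists>y\<in>V. height a y = 0 \<and> (\<forall>b\<in>R - {a}. height b y > 0))"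

definition walls :: "('a \<times> int) set"
  where "walls = {(a, lo a) | a. wall_root a}"

lemma walls_subset: "walls \<subseteq> refs"
  by (auto simp: walls_def wall_root_def)

lemma wall_root_root: "wall_root a \<Longrightarrow> a \<in> R"
  by (simp add: wall_root_def)

text \<open>Near y the hyperplane stays in the closed alcove. Hence for any z in it, a point p on
  the line through y and z, close to y, is in the facet, and z is an affine combination of y and
  p.\<close>

lemma is_wall_wall_root:
  assumes "wall_root a"
  shows "is_wall A (affine_hyperplane R a (lo a))"
proof -
  let ?H = "affine_hyperplane R a (lo a)"
  obtain y where a: "a \<in> R" and y: "y \<in> V" "height a y = 0" "\<And>b. b \<in> R - {a} \<Longrightarrow> height b y > 0"
    using assms by (auto simp: wall_root_def)
  have H: "x \<in> ?H \<longleftrightarrow> x \<in> V \<and> height a x = 0" for x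
    by (auto simp: affine_hyperplane_def level_def)
  have move: "y + t *\<^sub>R (z - y) \<in> ?H" if "z \<in> ?H" for z t
  proof -
    have "y + t *\<^sub>R (z - y) \<in> V"
      using that y H by (intro subspace_add subspace_scale subspace_diff subspace_V) auto
    then show ?thesis using that y unfolding H level_affine by simp
  qed
  have "affine ?H"
    unfolding affine_def
  proof (intro ballI allI impI)
    fix p q u v assume pq: "p \<in> ?H" "q \<in> ?H" and uv: "u + v = (1::real)"
    have "u *\<^sub>R p + v *\<^sub>R q = p + v *\<^sub>R (q - p)"
      using uv by (simp add: algebra_simps flip: scaleR_add_left)
    moreover have "p + v *\<^sub>R (q - p) \<in> V"
      using pq H by (intro subspace_add subspace_scale subspace_diff subspace_V) auto
    ultimately show "u *\<^sub>R p + v *\<^sub>R q \<in> ?H" using pq unfolding H by (simp add: level_affine)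
  qed
  then have "affine hull (closure A \<inter> ?H) \<subseteq> ?H" by (intro hull_minimal) auto
  moreover have "z \<in> affine hull (closure A \<inter> ?H)" if z: "z \<in> ?H" for z
  proof -
    obtain e where e: "e > 0" "\<And>b. b \<in> R - {a} \<Longrightarrow> height b y + e * (height b z - height b y) > 0"
      using finite_small_perturbation[of "R - {a}" "\<lambda>b. height b y" "\<lambda>b. height b z - height b y"]
        finite_R y(3) by blast
    define p where "p = y + e *\<^sub>R (z - y)"
    have pH: "p \<in> ?H" unfolding p_def by (rule move[OF z])
    have "height b p \<ge> 0" if "b \<in> R" for b
    proof (cases "b = a")
      case True
      then show ?thesis using pH H by simp
    next
      case False
      then have "height b y + e * (height b z - height b y) > 0" using e that by auto
      then show ?thesis unfolding p_def level_affine by (simp add: algebra_simps)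
    qed
    then have p: "p \<in> closure A \<inter> ?H" using pH H by (auto intro: closure_alcoveI)
    have "height b y \<ge> 0" if "b \<in> R" for b
      using y(2) y(3)[of b] that by (cases "b = a") auto
    then have y': "y \<in> closure A \<inter> ?H" using y H by (auto intro: closure_alcoveI)
    have "z = (1 - 1 / e) *\<^sub>R y + (1 / e) *\<^sub>R p"
      using e by (simp add: p_def algebra_simps)
    also have "\<dots> \<in> affine hull (closure A \<inter> ?H)"
      using p y' by (intro mem_affine affine_affine_hull hull_inc) auto
    finally show ?thesis .
  qed
  ultimately show ?thesis unfolding is_wall_def by blast
qed

lemma reduced_Cauchy_Schwarz:
  assumes a: "a \<in> R" and c: "c \<in> R" and "c \<noteq> a" "c \<noteq> - a"
  shows "(c \<bullet> a)\<^sup>2 < (c \<bullet> c) * (a \<bullet> a)"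
proof (rule ccontr)
  assume "\<not> ?thesis"
  then have "(c \<bullet> a)\<^sup>2 = (c \<bullet> c) * (a \<bullet> a)" using Cauchy_Schwarz_ineq[of c a] by simp
  then have "\<bar>c \<bullet> a\<bar> = norm c * norm a"
    by (simp add: norm_eq_sqrt_inner flip: real_sqrt_mult real_sqrt_abs)
  then have "collinear {0, a, c}"
    using norm_cauchy_schwarz_equal[of a c] by (simp add: inner_commute mult.commute)
  then obtain s where "c = s *\<^sub>R a"
    using root_nonzero[OF a] root_nonzero[OF c] by (auto simp: collinear_lemma)
  then have "s = 1 \<or> s = - 1" using root_system a c by (auto simp: root_system_def)
  with \<open>c = s *\<^sub>R a\<close> assms show False by auto
qed

text \<open>In a minimal subset of the inequalities describing \<open>A\<close>, every inequality is violated alone by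
  some point \<open>z\<close>; the segment from \<open>A\<close> to \<open>z\<close> leaves \<open>A\<close> through the interior of a face.\<close>

lemma walls_suffice:
  assumes x: "x \<in> V" "\<And>a. wall_root a \<Longrightarrow> height a x > 0"
  shows "x \<in> A"
proof -
  let ?P = "\<lambda>I. I \<subseteq> R \<and> (\<forall>x\<in>V. (\<forall>a\<in>I. height a x > 0) \<longrightarrow> x \<in> A)"
  have "?P R" by (auto intro: alcoveI)
  then obtain I where I: "?P I" and min: "\<And>J. ?P J \<Longrightarrow> card I \<le> card J"
    using ex_has_least_nat[of ?P R card] by blast
  obtain x0 where x0: "x0 \<in> A" using alcove_nonempty by auto
  have x0V: "x0 \<in> V" using x0 alcove_subset_V by auto
  have finI: "finite I" using I finite_R finite_subset by blast
  \<comment> \<open>If y violated c, the segment from y to the alcove point \<open>x0\<close> would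
    meet the hyperplane of c at a point satisfying all inequalities of I strictly, hence in
    A.\<close>
  have closed: "height c y \<ge> 0"
    if y: "y \<in> V" "\<And>b. b \<in> I \<Longrightarrow> height b y \<ge> 0" and c: "c \<in> R" for y c
  proof (rule ccontr)
    assume "\<not> height c y \<ge> 0"
    then have neg: "height c y < 0" by simp
    have pos: "height c x0 > 0" by (rule alcove_height[OF x0 c])
    define t where "t = - height c y / (height c x0 - height c y)"
    have t: "0 < t" "t < 1" using neg pos by (auto simp: t_def divide_simps)
    have 0: "height c (y + t *\<^sub>R (x0 - y)) = 0"
      unfolding level_affine using neg pos by (simp add: t_def field_simps)
    have "height b (y + t *\<^sub>R (x0 - y)) > 0" if "b \<in> I" for b
      unfolding level_affine using y(2)[OF that] alcove_height[OF x0, of b] I that t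
      by (intro add_nonneg_pos) auto
    moreover have "y + t *\<^sub>R (x0 - y) \<in> V"
      using y x0V by (intro subspace_add subspace_scale subspace_diff subspace_V) auto
    ultimately have "y + t *\<^sub>R (x0 - y) \<in> A" using I by blast
    then show False using alcove_height[OF _ c] 0 by fastforce
  qed
  have "wall_root a" if aI: "a \<in> I" for a
  proof -
    have a: "a \<in> R" using aI I by auto
    have "card (I - {a}) < card I" by (rule card_Diff1_less[OF finI aI])
    then have "\<not> ?P (I - {a})" using min[of "I - {a}"] not_le by blast
    then obtain z where z: "z \<in> V" "\<And>b. b \<in> I - {a} \<Longrightarrow> height b z > 0" "z \<notin> A"
      using I by blast
    then have za: "height a z \<le> 0" using I by force
    have x0a: "height a x0 > 0" by (rule alcove_height[OF x0 a])
    \<comment> \<open>The parameter at which the segment from \<open>x0\<close> to z meets the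
      hyperplane of a.\<close>
    define t where "t = height a x0 / (height a x0 - height a z)"
    have t: "0 < t" "t \<le> 1" using za x0a by (auto simp: t_def divide_simps)
    define y where "y = x0 + t *\<^sub>R (z - x0)"
    have yV: "y \<in> V" unfolding y_def using z x0V
      by (intro subspace_add subspace_scale subspace_diff subspace_V) auto
    have ya: "height a y = 0"
      unfolding y_def level_affine using za x0a by (simp add: t_def field_simps)
    have yI: "height b y > 0" if "b \<in> I - {a}" for b
      unfolding y_def level_affine using z(2)[OF that] alcove_height[OF x0, of b] I that t
      by (intro add_nonneg_pos) auto
    have yI': "height b y \<ge> 0" if "b \<in> I" for b
      using ya yI[of b] that by (cases "b = a") auto
    have "height c y > 0" if c: "c \<in> R - {a}" for c
    proof (rule ccontr)
      assume "\<not> height c y > 0"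
      then have yc: "height c y = 0" using closed[OF yV yI', of c] c by fastforce
      have "c \<noteq> - a" using height_minus[OF a, of y] ya yc by auto
      then have cs: "(c \<bullet> a)\<^sup>2 < (c \<bullet> c) * (a \<bullet> a)"
        using c a by (intro reduced_Cauchy_Schwarz) auto
      have cc: "c \<bullet> c > 0" using root_nonzero[of c] c by auto
      \<comment> \<open>This direction is orthogonal to a, and its product with c is the negative
        Cauchy-Schwarz defect. A small step along u from y keeps all inequalities of I but would
        violate c, against \<open>closed\<close>.\<close>
      define u where "u = (c \<bullet> a) *\<^sub>R a - (a \<bullet> a) *\<^sub>R c"
      have ua: "cartan_pairing u a = 0"
        by (simp add: u_def cartan_pairing_def inner_diff_left)
      have uc: "cartan_pairing u c < 0"
        using cs cc by (simp add: u_def cartan_pairing_def inner_diff_left inner_commute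
            power2_eq_square divide_less_0_iff algebra_simps)
      have lev: "height b (y + e *\<^sub>R u) = height b y + e * cartan_pairing u b" for b e
        by (simp add: level_def cartan_pairing_simps)
      obtain e where e: "e > 0" "\<And>b. b \<in> I - {a} \<Longrightarrow> height b y + e * cartan_pairing u b > 0"
        using finite_small_perturbation[of "I - {a}" "\<lambda>b. height b y" "\<lambda>b. cartan_pairing u b"]
          finI yI by blast
      have "height b (y + e *\<^sub>R u) \<ge> 0" if "b \<in> I" for b
        using e(2)[of b] that ya ua by (cases "b = a") (auto simp: lev)
      moreover have "y + e *\<^sub>R u \<in> V"
        using yV a c R_subset_V unfolding u_def
        by (intro subspace_add subspace_scale subspace_diff subspace_V) auto
      ultimately have "height c (y + e *\<^sub>R u) \<ge> 0" using closed c by blast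
      moreover have "e * cartan_pairing u c < 0" using e(1) uc by (rule mult_pos_neg)
      ultimately show False by (simp add: lev yc)
    qed
    then show ?thesis using a yV ya by (auto simp: wall_root_def)
  qed
  then show ?thesis using I x by blast
qed

end

section \<open>Generation by walls and point stabilizers\<close>

text \<open>Here p is a height on A and q the height of the same root at a boundary point; j changes
  \<open>lo\<close> into another integer. The boundary point is then on the same side as A unless it
  lies on the shifted hyperplane.\<close>

lemma int_shift_pos_iff:
  fixes p q :: real
  assumes "0 < p" "p < 1" "0 \<le> q" "q \<le> 1" "q + of_int j \<noteq> 0"
  shows "p + of_int j > 0 \<longleftrightarrow> q + of_int j > 0"
proof -
  consider "j = 0" | "real_of_int j \<ge> 1" | "real_of_int j \<le> - 1"
    by (metis int_one_le_iff_zero_less le_minus_one_simps(3) linorder_neqE of_int_1_le_iff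
        of_int_le_iff of_int_minus of_int_1 zle_diff1_eq diff_0)
  then show ?thesis using assms by cases auto
qed

context alcove
begin

text \<open>A facet point seen against all hyperplanes, not only those with integer
  \<open>lo\<close>: it lies on the wall alone, and every other hyperplane has it on the side of
  A.\<close>

lemma wall_witness:
  assumes "wall_root a"
  obtains y where "y \<in> V" "height a y = 0"
    "\<And>c k. c \<in> R \<Longrightarrow> level c k y = 0 \<Longrightarrow> aff_refl c k = aff_refl a (lo a)"
    "\<And>c k x. c \<in> R \<Longrightarrow> level c k y \<noteq> 0 \<Longrightarrow> x \<in> A \<Longrightarrow> level c k x > 0 \<longleftrightarrow> level c k y > 0"
proof -
  obtain y where a: "a \<in> R" and y: "y \<in> V" "height a y = 0" "\<And>b. b \<in> R \<Longrightarrow> b \<noteq> a \<Longrightarrow> height b y > 0"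
    using assms by (auto simp: wall_root_def)
  have bounds: "height c y > 0" "height c y < 1" if "c \<in> R" "c \<noteq> a" "c \<noteq> - a" for c
  proof -
    show "height c y > 0" using y that by auto
    have "- c \<noteq> a" using that by auto
    then show "height c y < 1"
      using y(3)[of "- c"] that by (simp add: uminus_root height_minus)
  qed
  have closed_bounds: "0 \<le> height c y" "height c y \<le> 1" if "c \<in> R" for c
    using bounds[OF that] y(2) height_minus[OF a, of y]
    by (cases "c = a"; cases "c = - a"; force)+
  have bounds_A: "0 < height c x" "height c x < 1" if "c \<in> R" "x \<in> A" for c x
    using alcove_height[OF that(2) that(1)] alcove_height[OF that(2) uminus_root[OF that(1)]]
      height_minus[OF that(1), of x]
    by auto
  have shift: "level c k z = height c z + of_int (lo c - k)" for c k z
    by (simp add: level_def)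
  show thesis
  proof (rule that[of y])
    fix c k assume c: "c \<in> R" and 0: "level c k y = 0"
    consider "c = a" | "c = - a" | "c \<noteq> a" "c \<noteq> - a" by blast
    then show "aff_refl c k = aff_refl a (lo a)"
    proof cases
      case 1
      then show ?thesis using 0 y by (simp add: level_def)
    next
      case 2
      then have "real_of_int k = real_of_int (- lo a)"
        using 0 y(2) by (simp add: level_def cartan_pairing_minus)
      then have "k = - lo a" by (simp only: of_int_eq_iff)
      then show ?thesis using 2 by (simp add: aff_refl_minus)
    next
      \<comment> \<open>Here the height is strictly between 0 and 1, so no integer can make the
        level vanish.\<close>
      case 3
      have "0 < real_of_int (k - lo c)" "real_of_int (k - lo c) < 1"
        using bounds[OF c 3] 0 shift[of c k y] by linarith+
      then show ?thesis unfolding of_int_0_less_iff of_int_less_1_iff by linarith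
    qed
  next
    fix c k x assume c: "c \<in> R" and n: "level c k y \<noteq> 0" and x: "x \<in> A"
    show "level c k x > 0 \<longleftrightarrow> level c k y > 0"
      using n unfolding shift[of c k]
      by (intro int_shift_pos_iff bounds_A[OF c x] closed_bounds[OF c])
  qed (use y in auto)
qed

text \<open>The facet point y is fixed by the wall reflection, hence adjacent to A and to its mirror
  image. A hyperplane other than the wall misses y, so both alcoves lie on the side of y.\<close>

lemma wall_separates_only:
  assumes a: "wall_root a" and c: "c \<in> R" and ne: "aff_refl c k \<noteq> aff_refl a (lo a)" and x: "x \<in> A"
  shows "level c k (aff_refl a (lo a) x) > 0 \<longleftrightarrow> level c k x > 0"
proof -
  have aR: "a \<in> R" by (rule wall_root_root[OF a])
  obtain y where y: "height a y = 0"
    "\<And>c k. c \<in> R \<Longrightarrow> level c k y = 0 \<Longrightarrow> aff_refl c k = aff_refl a (lo a)"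
    "\<And>c k x. c \<in> R \<Longrightarrow> level c k y \<noteq> 0 \<Longrightarrow> x \<in> A \<Longrightarrow> level c k x > 0 \<longleftrightarrow> level c k y > 0"
    using wall_witness[OF a] by metis
  have fix_y: "aff_refl a (lo a) y = y" using y(1) by (simp add: aff_refl_def)
  obtain d j where d: "d \<in> R" "\<And>x. level c k (aff_refl a (lo a) x) = level d j x"
    using aff_refl_conj[OF c aR, of k "lo a"] by metis
  have n: "level c k y \<noteq> 0" using y(2)[OF c] ne by auto
  have e: "level d j y = level c k y" using d(2)[of y] by (simp add: fix_y)
  show ?thesis using y(3)[OF c n x] y(3)[OF d(1) _ x, of j] n by (simp add: d(2) e)
qed

lemma list_sign_change:
  assumes "\<not> Q []" "Q l"
  obtains u p w where "l = u @ p # w" "\<not> Q u" "Q (u @ [p])"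
proof -
  have "\<exists>u p w. l = u @ p # w \<and> \<not> Q u \<and> Q (u @ [p])" using assms(2)
  proof (induction l rule: rev_induct)
    case Nil
    then show ?case using assms(1) by simp
  next
    case (snoc p l)
    show ?case
    proof (cases "Q l")
      case True
      then obtain u q w where "l = u @ q # w" "\<not> Q u" "Q (u @ [q])" using snoc.IH by blast
      then show ?thesis by (intro exI[of _ u] exI[of _ q] exI[of _ "w @ [p]"]) simp
    next
      case False
      then show ?thesis using snoc.prems by (intro exI[of _ l] exI[of _ p] exI[of _ "[]"]) simp
    qed
  qed
  then show thesis using that by blast
qed

text \<open>Deletion argument: the gallery belonging to a word that returns to \<open>A\<close> has to cross its
  first wall a second time, and the two letters of these crossings cancel.\<close>

lemma word_fixing_alcove:
  assumes x: "x \<in> A" and "l \<in> lists walls" "word l x \<in> A"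
  shows "word l = id"
  using assms(2,3)
proof (induction l rule: length_induct)
  case (1 l)
  show ?case
  proof (cases l)
    case (Cons p l')
    obtain a where p: "p = (a, lo a)" and a: "wall_root a"
      using 1 Cons by (auto simp: walls_def)
    have aR: "a \<in> R" by (rule wall_root_root[OF a])
    have a0: "a \<noteq> 0" by (rule root_nonzero[OF aR])
    let ?s = "aff_refl a (lo a)"
    \<comment> \<open>\<open>Q u\<close> says that after the first letter and then u the gallery is
      on the side of A of the first wall. It fails at the start and holds at the end, so some letter
      q crosses back.\<close>
    define Q where "Q u \<longleftrightarrow> height a (?s (word u x)) > 0" for u
    have "\<not> Q []" using alcove_height[OF x aR] a0 by (simp add: Q_def level_aff_refl_self)
    moreover have "Q l'" using alcove_height[OF "1.prems"(2) aR] by (simp add: Q_def Cons p)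
    ultimately obtain u q w where l': "l' = u @ q # w" and nu: "\<not> Q u" and uq: "Q (u @ [q])"
      by (rule list_sign_change)
    have in_walls: "u \<in> lists walls" "w \<in> lists walls" "q \<in> walls"
      using "1.prems"(1) by (auto simp: Cons l')
    then obtain b where q: "q = (b, lo b)" and b: "wall_root b" by (auto simp: walls_def)
    let ?t = "aff_refl b (lo b)"
    have "set u \<subseteq> refs" using in_walls walls_subset by auto
    then have g: "?s \<circ> word u \<in> words refs"
      using aR by (intro words_comp aff_refl_in_words) (auto simp: words_def)
    from words_conj[OF g aR, of "lo a"] obtain c k where c: "c \<in> R"
      "\<And>x. height a ((?s \<circ> word u) x) = level c k x"
      "?s \<circ> (?s \<circ> word u) = (?s \<circ> word u) \<circ> aff_refl c k" by blast
    have "\<not> level c k x > 0" using nu c(2)[of x] by (simp add: Q_def)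
    moreover have "level c k (?t x) > 0" using uq c(2)[of "?t x"] by (simp add: Q_def word_append q)
    \<comment> \<open>Pulled back by the prefix, the first wall separates x from its neighbour
      \<open>?t x\<close>, so it is the wall of t. Thus conjugating s by the prefix gives t, and
      both letters can be deleted.\<close>
    ultimately have "aff_refl c k = ?t" using wall_separates_only[OF b c(1) _ x] by blast
    then have "word u = (?s \<circ> word u) \<circ> ?t"
      using c(3) aff_refl_comp_self[OF a0, of "lo a"] by (metis comp_assoc id_comp)
    then have e: "word l = word (u @ w)"
      by (simp add: Cons l' p q word_append flip: comp_assoc)
    have "word (u @ w) = id"
      using "1.IH"[rule_format, of "u @ w"] "1.prems"(2) in_walls e by (auto simp: Cons l')
    with e show ?thesis by simp
  qed simp
qed

text \<open>The displacement of \<open>x0\<close> by a reflection is its level at \<open>x0\<close>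
  times the norm of its root. If r is a counterexample of least displacement, some wall separates
  \<open>r x0\<close> from A, and conjugating r by the reflection s in that wall gives a
  counterexample of smaller displacement.\<close>

lemma refl_in_words_walls:
  assumes "a \<in> R"
  shows "aff_refl a k \<in> words walls"
proof (rule ccontr)
  assume contra: "aff_refl a k \<notin> words walls"
  obtain x0 where x0: "x0 \<in> A" using alcove_nonempty by auto
  define Q where "Q = {aff_refl a k | a k. a \<in> R \<and> aff_refl a k \<notin> words walls}"
  have "Q \<subseteq> words refs" by (auto simp: Q_def intro: aff_refl_in_words)
  moreover have "Q \<noteq> {}" using contra assms by (auto simp: Q_def)
  ultimately obtain r where r: "r \<in> Q" "\<And>h. h \<in> Q \<Longrightarrow> norm (r x0 - x0) \<le> norm (h x0 - x0)"
    using words_minimal_distance[of Q x0 x0] by metis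
  \<comment> \<open>Of the two labels of r, the one with positive level at \<open>x0\<close> is
    taken.\<close>
  obtain b m where b: "b \<in> R" "r = aff_refl b m" "level b m x0 > 0"
  proof -
    from r(1) obtain b m where bm: "b \<in> R" "r = aff_refl b m" by (auto simp: Q_def)
    show thesis
    proof (cases "level b m x0 > 0")
      case False
      then have "level b m x0 < 0" using alcove_level_nonzero[OF x0 bm(1), of m] by linarith
      then show thesis using that[of "- b" "- m"] bm
        by (simp add: uminus_root aff_refl_minus level_minus)
    qed (use that bm in blast)
  qed
  have "r x0 \<notin> A"
  proof
    assume rA: "r x0 \<in> A"
    have neg: "level b m (r x0) < 0" using b root_nonzero by (simp add: level_aff_refl_self)
    \<comment> \<open>The midpoint of \<open>x0\<close> and \<open>r x0\<close> lies on the
      hyperplane of r, but would lie in A by convexity.\<close>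
    let ?z = "x0 + (1/2) *\<^sub>R (r x0 - x0)"
    have "height a x0 \<ge> 0" if "a \<in> R" for a
      using alcove_height[OF x0 that] by simp
    then have "?z \<in> A" using toward_alcove[of x0 "r x0" "1/2"] x0 rA alcove_subset_V by auto
    moreover have "level b m ?z = 0"
      unfolding level_affine using b root_nonzero by (simp add: level_aff_refl_self)
    ultimately show False using alcove_level_nonzero b(1) by blast
  qed
  moreover have "r \<in> words refs" using b by (simp add: aff_refl_in_words)
  then have "r x0 \<in> V" using words_in_V x0 alcove_subset_V by blast
  ultimately obtain c where c: "wall_root c" "\<not> height c (r x0) > 0"
    using walls_suffice by blast
  have cR: "c \<in> R" by (rule wall_root_root[OF c(1)])
  let ?s = "aff_refl c (lo c)"
  have s_in: "?s \<in> words walls" using c by (auto simp: walls_def intro: aff_refl_in_words)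
  have c0: "height c x0 > 0" by (rule alcove_height[OF x0 cR])
  have "height c (r x0) = height c x0 - level b m x0 * cartan_pairing b c"
    by (simp add: b(2) aff_refl_def level_def cartan_pairing_simps)
  then have "level b m x0 * cartan_pairing b c > 0" using c(2) c0 by linarith
  then have "cartan_pairing b c > 0" using b(3) by (simp add: zero_less_mult_iff)
  then have "b \<bullet> c > 0" by (simp add: cartan_pairing_def zero_less_divide_iff)
      (metis inner_ge_zero not_le)
  then have cb: "cartan_pairing c b > 0"
    using root_nonzero[OF b(1)] by (simp add: cartan_pairing_def inner_commute)
  have "aff_refl b m \<noteq> ?s" using s_in r(1) b(2) by (auto simp: Q_def)
  from wall_separates_only[OF c(1) b(1) this x0]
  \<comment> \<open>The new level decreases but stays positive, since only the wall of c separates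
    \<open>x0\<close> from its image; hence its absolute value decreases too.\<close>
  have pos: "level b m (?s x0) > 0" using b(3) by simp
  have "level b m (?s x0) = level b m x0 - height c x0 * cartan_pairing c b"
    by (simp add: aff_refl_def level_def cartan_pairing_simps)
  then have less: "level b m (?s x0) < level b m x0" using c0 cb by simp
  from aff_refl_conj[OF b(1) cR, of m "lo c"] obtain d j where
    d: "d \<in> R" "norm d = norm b" "\<And>x. level b m (?s x) = level d j x"
      "aff_refl b m \<circ> ?s = ?s \<circ> aff_refl d j" by metis
  have ss: "?s \<circ> ?s = id" by (rule aff_refl_comp_self[OF root_nonzero[OF cR]])
  have "aff_refl b m = ?s \<circ> aff_refl d j \<circ> ?s"
    using d(4) ss by (metis comp_assoc comp_id)
  moreover have "aff_refl b m \<notin> words walls" using r(1) b(2) by (auto simp: Q_def)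
  ultimately have "aff_refl d j \<notin> words walls" using s_in words_comp by metis
  then have "norm (r x0 - x0) \<le> norm (aff_refl d j x0 - x0)"
    using d(1) by (intro r(2)) (auto simp: Q_def)
  then have "level b m x0 * norm b \<le> level b m (?s x0) * norm b"
    using b(3) pos by (simp add: b(2) aff_refl_def d(2) flip: d(3))
  then show False using less root_nonzero[OF b(1)] by simp
qed

lemma words_walls: "words walls = words refs"
proof
  show "words walls \<subseteq> words refs" by (rule words_mono[OF walls_subset])
  show "words refs \<subseteq> words walls"
  proof
    fix f assume "f \<in> words refs"
    then show "f \<in> words walls"
    proof (induction rule: words_induct)
      case id
      show ?case by (rule words_id)
    next
      case (refl a k f)
      then show ?case by (intro words_comp refl_in_words_walls) auto
    qed
  qed
qed

lemma words_fixing_alcove: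
  assumes "f \<in> words refs" "x \<in> A" "f x \<in> A"
  shows "f = id"
proof -
  have "f \<in> words walls" using assms(1) by (simp only: words_walls)
  then obtain l where "l \<in> lists walls" "f = word l" by (auto simp: words_def)
  with word_fixing_alcove[OF assms(2)] assms(3) show ?thesis by blast
qed

section \<open>Point stabilizers in the affine Weyl group\<close>

lemma words_into_closed_alcove:
  assumes "v \<in> V"
  obtains g where "g \<in> words refs" "\<And>a. a \<in> R \<Longrightarrow> height a (g v) \<ge> 0"
proof -
  obtain x0 where x0: "x0 \<in> A" using alcove_nonempty by auto
  obtain g where g: "g \<in> words refs" "\<And>h. h \<in> words refs \<Longrightarrow> norm (g v - x0) \<le> norm (h v - x0)"
    using words_minimal_distance[of "words refs" v x0] words_id by blast
  have "height a (g v) \<ge> 0" if a: "a \<in> R" for a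
  proof (rule ccontr)
    assume "\<not> height a (g v) \<ge> 0"
    then have "norm (aff_refl a (lo a) (g v) - x0) < norm (g v - x0)"
      using alcove_height[OF x0 a] root_nonzero[OF a] by (intro aff_refl_closer) auto
    moreover have "aff_refl a (lo a) \<circ> g \<in> words refs"
      using g a by (intro words_comp aff_refl_in_words) auto
    then have "norm (g v - x0) \<le> norm ((aff_refl a (lo a) \<circ> g) v - x0)" by (rule g(2))
    ultimately show False by simp
  qed
  with g(1) show thesis using that by blast
qed

lemma stabilizer_generated_by_walls:
  assumes v: "v \<in> V" "\<And>a. a \<in> R \<Longrightarrow> height a v \<ge> 0"
  shows "{f \<in> words refs. f v = v} = words {(a, lo a) | a. wall_root a \<and> height a v = 0}"
    (is "_ = words ?J")
proof
  have J: "?J \<subseteq> refs" by (auto dest: wall_root_root)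
  have Jv: "f v = v" if "f \<in> words ?J" for f
    using that by (induction rule: words_induct) (auto simp: aff_refl_def)
  show "words ?J \<subseteq> {f \<in> words refs. f v = v}" using words_mono[OF J] Jv by auto
  show "{f \<in> words refs. f v = v} \<subseteq> words ?J"
  proof safe
    fix f assume f: "f \<in> words refs" "f v = v"
    obtain x0 where x0: "x0 \<in> A" using alcove_nonempty by auto
    have x0V: "x0 \<in> V" using x0 alcove_subset_V by auto
    \<comment> \<open>The coset of f modulo the walls through v; q in it brings \<open>x0\<close>
      nearest to itself, and the aim is q = id.\<close>
    let ?Q = "(\<lambda>h. h \<circ> f) ` words ?J"
    have "?Q \<subseteq> words refs" using f(1) words_mono[OF J] words_comp by blast
    then obtain q where q: "q \<in> ?Q" "\<And>h. h \<in> ?Q \<Longrightarrow> norm (q x0 - x0) \<le> norm (h x0 - x0)"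
      using words_minimal_distance[of ?Q x0 x0] words_id by blast
    then obtain h where h: "h \<in> words ?J" "q = h \<circ> f" by auto
    have qr: "q \<in> words refs" using q(1) \<open>?Q \<subseteq> words refs\<close> by blast
    have qv: "q v = v" using h f Jv by simp
    define y where "y = q x0"
    have yV: "y \<in> V" unfolding y_def by (rule words_in_V[OF qr x0V])
    \<comment> \<open>Otherwise reflecting y in this wall through v would bring it nearer to
      \<open>x0\<close> within the coset. The height is nonzero because no element of the group
      moves \<open>x0\<close> onto a hyperplane.\<close>
    have yJ: "height a y > 0" if a: "wall_root a" "height a v = 0" for a
    proof (rule ccontr)
      assume "\<not> height a y > 0"
      have aR: "a \<in> R" by (rule wall_root_root[OF a(1)])
      obtain c k where "c \<in> R" "height a y = level c k x0"
        using words_conj[OF qr aR, of "lo a"] by (auto simp: y_def)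
      then have "height a y \<noteq> 0" using alcove_level_nonzero[OF x0] by simp
      then have "norm (aff_refl a (lo a) y - x0) < norm (y - x0)"
        using \<open>\<not> height a y > 0\<close> alcove_height[OF x0 aR] root_nonzero[OF aR]
        by (intro aff_refl_closer) auto
      moreover have "aff_refl a (lo a) \<circ> q \<in> ?Q"
        unfolding h comp_assoc[symmetric] using a h
        by (intro imageI words_comp aff_refl_in_words) auto
      then have "norm (q x0 - x0) \<le> norm ((aff_refl a (lo a) \<circ> q) x0 - x0)" by (rule q(2))
      ultimately show False by (simp add: y_def)
    qed
    have "\<exists>e>0. e \<le> 1 \<and>
        (\<forall>a\<in>{a \<in> R. height a v > 0}. height a v + e * (height a y - height a v) > 0)"
      by (rule finite_small_perturbation) (use finite_R in simp_all)
    then obtain e where e: "e > 0" "e \<le> 1"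
      "\<And>a. a \<in> R \<Longrightarrow> height a v > 0 \<Longrightarrow> height a v + e * (height a y - height a v) > 0"
      by blast
    \<comment> \<open>For the walls through v the side is that of y; for the others the small e
      keeps the sign at v. As q is affine and fixes v, it maps a point of A near v to this point of
      A.\<close>
    have "v + e *\<^sub>R (y - v) \<in> A"
    proof (rule walls_suffice)
      show "v + e *\<^sub>R (y - v) \<in> V"
        using v yV by (intro subspace_add subspace_scale subspace_diff subspace_V) auto
      fix a assume a: "wall_root a"
      have aR: "a \<in> R" by (rule wall_root_root[OF a])
      show "height a (v + e *\<^sub>R (y - v)) > 0"
      proof (cases "height a v = 0")
        case True
        then show ?thesis unfolding level_affine using yJ[OF a] e by simp
      next
        case False
        then have "height a v > 0" using v(2)[OF aR] by simp
        then show ?thesis using e(3)[OF aR] unfolding level_affine by (simp add: algebra_simps)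
      qed
    qed
    moreover have "q (v + e *\<^sub>R (x0 - v)) = v + e *\<^sub>R (y - v)"
      using words_affine[OF qr] by (simp add: qv y_def)
    moreover have "v + e *\<^sub>R (x0 - v) \<in> A" by (rule toward_alcove[OF v x0 e(1,2)])
    ultimately have "h \<circ> f = id" using words_fixing_alcove[OF qr] h(2) by metis
    moreover obtain g where "g \<in> words ?J" "g \<circ> h = id" using words_inverse[OF h(1) J] by blast
    ultimately have "f = g" by (metis comp_assoc comp_id id_comp)
    with \<open>g \<in> words ?J\<close> show "f \<in> words ?J" by simp
  qed
qed

end

section \<open>The coset stabilizer as a point stabilizer\<close>

theorem corollary2p2:
  fixes R :: "'a::euclidean_space set" and A :: "'a set" and v :: 'a
  assumes "root_system R"
    and "A \<in> alcoves R"
    and "v \<in> root_space R"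
  shows "\<exists>P. finite P \<and> parabolic_subgroup R A P \<and>
    (weyl_group R)\<lparr>carrier := weyl_coset_stabilizer R v\<rparr>
      \<cong> (affine_weyl_group R)\<lparr>carrier := P\<rparr>"
proof -
  interpret alcove R A by unfold_locales fact+
  let ?W = "weyl_group R" and ?G = "affine_weyl_group R"
  interpret G: group ?G by (rule group_affine_weyl_group)
  \<comment> \<open>The stabilizer of v itself; conjugating the stabilizer of \<open>h v\<close> by
    the inverse g of h gives P.\<close>
  define P where "P = (\<lambda>f. restrict f V) ` {f \<in> words refs. f v = v}"
  obtain h where h: "h \<in> words refs" "\<And>a. a \<in> R \<Longrightarrow> height a (h v) \<ge> 0"
    using words_into_closed_alcove[OF assms(3)] by metis
  have hv: "h v \<in> V" by (rule words_in_V[OF h(1) assms(3)])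
  define J where "J = {(a, lo a) | a. wall_root a \<and> height a (h v) = 0}"
  have J_refs: "J \<subseteq> refs"
  proof
    fix p assume "p \<in> J"
    then obtain a where "p = (a, lo a)" "wall_root a" unfolding J_def by blast
    then show "p \<in> refs" using wall_root_root by simp
  qed
  have stab: "{f \<in> words refs. f (h v) = h v} = words J"
    using stabilizer_generated_by_walls[OF hv h(2)] by (simp add: J_def)
  obtain g where g: "g \<in> words refs" "g \<circ> h = id" "h \<circ> g = id"
    using words_inverse[OF h(1) subset_refl] by blast
  let ?g = "restrict g V" and ?h = "restrict h V"
  have carrier: "restrict f V \<in> carrier ?G" if "f \<in> words refs" for f
    using that by (simp add: carrier_affine_weyl_group)
  have "?h \<otimes>\<^bsub>?G\<^esub> ?g = \<one>\<^bsub>?G\<^esub>"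
    unfolding affine_weyl_mult[OF h(1) g(1)] g by (auto simp: affine_weyl_group_def BijGroup_def)
  then have inv_g: "inv\<^bsub>?G\<^esub> ?g = ?h" by (intro G.inv_equality carrier g h)

  have conj: "?g \<otimes>\<^bsub>?G\<^esub> restrict f V \<otimes>\<^bsub>?G\<^esub> inv\<^bsub>?G\<^esub> ?g = restrict (g \<circ> f \<circ> h) V"
    if "f \<in> words refs" for f
    unfolding inv_g using that g h by (simp add: affine_weyl_mult words_comp)
  have "{f \<in> words refs. f v = v} = (\<lambda>f. g \<circ> f \<circ> h) ` words J"
  proof safe
    fix f assume f: "f \<in> words refs" "f v = v"
    have "g (h v) = v" using g by (auto simp: fun_eq_iff)
    with f have "h \<circ> f \<circ> g \<in> {f \<in> words refs. f (h v) = h v}" using g h by (simp add: words_comp)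
    moreover have "f = g \<circ> (h \<circ> f \<circ> g) \<circ> h" using g by (metis comp_assoc comp_id id_comp)
    ultimately show "f \<in> (\<lambda>f. g \<circ> f \<circ> h) ` words J" unfolding stab by blast
  next
    fix f assume "f \<in> words J"
    then have f: "f \<in> words refs" "f (h v) = h v" using stab by auto
    show "g \<circ> f \<circ> h \<in> words refs" using f g h by (simp add: words_comp)
    show "(g \<circ> f \<circ> h) v = v" using f g by (simp add: fun_eq_iff)
  qed
  then have "P = (\<lambda>p. ?g \<otimes>\<^bsub>?G\<^esub> p \<otimes>\<^bsub>?G\<^esub> inv\<^bsub>?G\<^esub> ?g) ` (\<lambda>f. restrict f V) ` words J"
    using conj words_mono[OF J_refs] unfolding P_def by (auto simp: image_image intro!: image_cong)
  also have "(\<lambda>f. restrict f V) ` words J = generate ?G ((\<lambda>(a, k). affine_reflection R a k) ` J)"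
    by (rule generate_affine_weyl[OF J_refs, symmetric])
  finally have "P = (\<lambda>p. ?g \<otimes>\<^bsub>?G\<^esub> p \<otimes>\<^bsub>?G\<^esub> inv\<^bsub>?G\<^esub> ?g) `
      generate ?G ((\<lambda>(a, k). affine_reflection R a k) ` J)" .
  moreover have "(\<lambda>(a, k). affine_reflection R a k) ` J \<subseteq> simple_reflections R A"
    by (auto simp: J_def simple_reflections_def dest: wall_root_root is_wall_wall_root)
  ultimately have parabolic: "parabolic_subgroup R A P"
    unfolding parabolic_subgroup_def using carrier[OF g(1)] by blast

  \<comment> \<open>The map fixing v with linear part w; the defining condition of the coset
    stabilizer makes its translation part a lattice vector.\<close>
  define \<phi> where "\<phi> w = restrict (\<lambda>x. w x + (v - w v)) V" for w :: "'a \<Rightarrow> 'a"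
  have W: "w \<in> carrier ?W" "v - w v \<in> root_lattice R" "linear w"
    and \<phi>_words: "(\<lambda>x. w x + (v - w v)) \<in> words refs"
    if w: "w \<in> weyl_coset_stabilizer R v" for w
  proof -
    show *: "w \<in> carrier ?W" using w by (simp add: weyl_coset_stabilizer_def)
    then show "linear w" using weyl_group_acts[OF root_system] by blast
    show **: "v - w v \<in> root_lattice R"
      using w root_lattice_diff[OF root_lattice_zero, of "w v - v" R]
      by (simp add: weyl_coset_stabilizer_def)
    show "(\<lambda>x. w x + (v - w v)) \<in> words refs" by (rule weyl_translation_in_words[OF * **])
  qed
  have bij: "bij_betw \<phi> (weyl_coset_stabilizer R v) P"
    unfolding bij_betw_def
  proof
    show "inj_on \<phi> (weyl_coset_stabilizer R v)"
    proof (rule inj_onI)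
      fix w w' assume w: "w \<in> weyl_coset_stabilizer R v" "w' \<in> weyl_coset_stabilizer R v"
        and eq: "\<phi> w = \<phi> w'"
      \<comment> \<open>The maps agree on the root space only: the point 0 compares the translation
        parts, the roots compare the linear parts.\<close>
      have *: "w x + (v - w v) = w' x + (v - w' v)" if "x \<in> V" for x
        using fun_cong[OF eq, of x] that by (simp add: \<phi>_def)
      have "w v = w' v" using *[OF subspace_0[OF subspace_V]] W(3) w by (simp add: linear_0)
      then have "w a = w' a" if "a \<in> R" for a using *[of a] that R_subset_V by auto
      then show "w = w'" using W(1) w by (intro weyl_eqI)
    qed
    show "\<phi> ` weyl_coset_stabilizer R v = P"
    proof safe
      fix w assume "w \<in> weyl_coset_stabilizer R v"
      then show "\<phi> w \<in> P" using \<phi>_words unfolding P_def \<phi>_def by (intro imageI) simp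
    next
      fix p assume "p \<in> P"
      then obtain f where f: "f \<in> words refs" "f v = v" "p = restrict f V" by (auto simp: P_def)
      obtain w t where wt: "w \<in> carrier ?W" "t \<in> root_lattice R" "\<And>x. f x = w x + t"
        using word_decompose[OF f(1)] by auto
      \<comment> \<open>Fixing v determines the translation part from w, so f is the image of its
        linear part.\<close>
      have t: "t = v - w v" using wt(3)[of v] f(2) by (metis add_diff_cancel_left')
      have "w v - v \<in> root_lattice R" using root_lattice_diff[OF root_lattice_zero wt(2)] t by simp
      then have "w \<in> weyl_coset_stabilizer R v" using wt by (simp add: weyl_coset_stabilizer_def)
      moreover have "p = \<phi> w" using wt(3) by (simp add: f \<phi>_def t restrict_def fun_eq_iff)
      ultimately show "p \<in> \<phi> ` weyl_coset_stabilizer R v" by blast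
    qed
  qed
  have "finite P"
    using bij finite_subset[OF _ finite_weyl_group, of "weyl_coset_stabilizer R v"]
    by (auto simp: weyl_coset_stabilizer_def dest: bij_betw_finite)
  have "\<phi> (w \<otimes>\<^bsub>?W\<^esub> w') = \<phi> w \<otimes>\<^bsub>?G\<^esub> \<phi> w'"
    if w: "w \<in> weyl_coset_stabilizer R v" "w' \<in> weyl_coset_stabilizer R v" for w w'
  proof -
    have "\<phi> w \<otimes>\<^bsub>?G\<^esub> \<phi> w' = restrict ((\<lambda>x. w x + (v - w v)) \<circ> (\<lambda>x. w' x + (v - w' v))) V"
      unfolding \<phi>_def by (intro affine_weyl_mult \<phi>_words w)
    also have "(\<lambda>x. w x + (v - w v)) \<circ> (\<lambda>x. w' x + (v - w' v)) = (\<lambda>x. (w \<circ> w') x + (v - (w \<circ> w') v))"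
      using W(3)[OF w(1)] by (simp add: fun_eq_iff linear_add linear_diff)
    finally show ?thesis
      unfolding weyl_group_mult[OF root_system W(1)[OF w(1)] W(1)[OF w(2)]] by (simp only: \<phi>_def)
  qed
  then have "\<phi> \<in> iso (?W\<lparr>carrier := weyl_coset_stabilizer R v\<rparr>) (?G\<lparr>carrier := P\<rparr>)"
    using bij by (auto simp: iso_def hom_def dest: bij_betwE)
  with \<open>finite P\<close> parabolic show ?thesis by (auto intro: is_isoI)
qed

end
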